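(* Let $D=D(\mathbf p)$, $E=E(\mathbf p)$, $\bar H=\bar H(\mathbf p)$, $\mathbf d_s$, $\mathbf d_r$, $r$ and the loss $\mathcal J$ be as defined in the context. Let $\mathbf w$ be the solution of the forward problem $$\mathbf w_{tt}=D\mathbf w+E\mathbf w_t+f(t)\mathbf d_s,\quad 0<t\le T,\qquad \mathbf w=\mathbf w_t=0,\quad t=0,$$ and let $\boldsymbol\lambda$ be the solution of the adjoint equation $$\boldsymbol\lambda_{\tau\tau}=D\boldsymbol\lambda+E\boldsymbol\lambda_\tau-r(\mathbf w,\tau)\mathbf d_r,\quad 0\le\tau\le T,\qquad \boldsymbol\lambda=\boldsymbol\lambda_\tau=0,\quad\tau=0,$$ where $\tau=T-t$ and $r(\mathbf w,\tau)$ denotes the residual $r$ evaluated at the time $t=T-\tau$. Then the gradient of $\mathcal J$ (with $\mathbf w$ regarded as a function of $\mathbf p$ through the forward problem) is given, for $i=1,\dots,m_{\Gamma_I}$, by $$\frac{\partial\mathcal J}{\partial p_i}=\int_0^T\left[-\Big(\boldsymbol\lambda,\frac{\partial D}{\partial p_i}\mathbf w\Big)_{\bar H}+\Big(\boldsymbol\lambda_t,\frac{\partial E}{\partial p_i}\mathbf w\Big)_{\bar H}\right]dt+\gamma\,(D_2\mathbf e_i,D_2\mathbf p)_H,$$ where $\mathbf e_i$ is the vector with entry $1$ at position $i$ and zeros elsewhere, and $\boldsymbol\lambda$ is viewed as a function of $t$.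
   Context: One-dimensional SBP operators. For an interval discretized by $m$ equidistant points (in each coordinate direction the operators depend on the number of points and the spacing; the same symbols are used in all directions), $H$ is a diagonal matrix with positive diagonal (the norm matrix), $e_l=[1,0,\dots,0]^\top$, $e_r=[0,\dots,0,1]^\top$, and $I_m$ is the $m\times m$ identity. $D_1\approx\partial/\partial x$ satisfies $HD_1+D_1^\top H=-e_le_l^\top+e_re_r^\top$. For a coefficient vector $\mathbf c\in\mathbb R^m$, $D_2^{(\mathbf c)}\approx\partial_x c\,\partial_x$ satisfies $HD_2^{(\mathbf c)}=-M^{(\mathbf c)}-(e_l^\top\mathbf c)e_ld_l^\top+(e_r^\top\mathbf c)e_rd_r^\top$, $M^{(\mathbf c)}=D_1^\top H\,\mathrm{diag}(\mathbf c)D_1+R^{(\mathbf c)}$, with $R^{(\mathbf c)}$ symmetric, linear in $\mathbf c$, and positive semidefinite when $\mathbf c$ has nonnegative entries; $d_l^\top=e_l^\top\hat D_1$, $d_r^\top=e_r^\top\hat D_1$, where the first and last rows of the matrix $\hat D_1$ approximate $\partial/\partial x$. $D_2=D_2^{(\mathbf 1)}$, $\mathbf 1$ the all-ones vector. For a matrix $A$, $(\mathbf u,\mathbf v)_A=\mathbf u^\top A\mathbf v$, $\|\mathbf u\|_A^2=(\mathbf u,\mathbf u)_A$. Operators on the fixed rectangle $\Omega^+$ ($N^+=m_x^+m_y^+$ points, column-major ordering; all independent of $\mathbf p$): $D_L^+=D_2\otimes I_{m_y^+}+I_{m_x^+}\otimes D_2$, $H^+=(H\otimes I_{m_y^+})(I_{m_x^+}\otimes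 H)$, $e_w^+=e_l^\top\otimes I_{m_y^+}$, $e_e^+=e_r^\top\otimes I_{m_y^+}$, $e_s^+=I_{m_x^+}\otimes e_l^\top$, $e_n^+=I_{m_x^+}\otimes e_r^\top$, $d_w^+=-(d_l^\top\otimes I_{m_y^+})$, $d_e^+=d_r^\top\otimes I_{m_y^+}$, $d_s^+=-(I_{m_x^+}\otimes d_l^\top)$, $d_n^+=I_{m_x^+}\otimes d_r^\top$; $H_k^+$ ($k=w,e,s,n$) is the one-dimensional norm matrix $H$ in the direction along side $k$. Shape parameter and grid on $\Omega_p^-$. $\mathbf p=[p_1,\dots,p_{m_{\Gamma_I}}]$, $m_{\Gamma_I}=m_x^+=m_\xi^-$, contains the $y$-coordinates of the bottom boundary. The grid coordinates in $\Omega_p^-$ (column-major vectors $\mathbf x,\mathbf y\in\mathbb R^{N^-}$, $N^-=m_\xi^-m_\eta^-$) are $x_{i,j}=x_l+(x_r-x_l)\xi_i$, $y_{i,j}=p_i+(L_I-p_i)\eta_j$, where $\xi_i,\eta_j$ are equidistant grid points of $[0,1]$, $x_l<x_r$ are the horizontal end points, and $L_I$ is the fixed $y$-coordinate of the interface. Operators on $\Omega_p^-$: $D_\xi^-=D_1\otimes I_{m_\eta^-}$, $D_\eta^-=I_{m_\xi^-}\otimes D_1$, $\hat D_\xi^-=\hat D_1\otimes I_{m_\eta^-}$, $\hat D_\eta^-=I_{m_\xi^-}\otimes\hat D_1$, $H_\xi^-=H\otimes I_{m_\eta^-}$, $H_\eta^-=I_{m_\xi^-}\otimes H$, $e_w^-=e_l^\top\otimes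 I_{m_\eta^-}$, $e_e^-=e_r^\top\otimes I_{m_\eta^-}$, $e_s^-=I_{m_\xi^-}\otimes e_l^\top$, $e_n^-=I_{m_\xi^-}\otimes e_r^\top$. Diagonal matrices: $\mathbf X_\xi=\mathrm{diag}(D_\xi^-\mathbf x)$, $\mathbf X_\eta=\mathrm{diag}(D_\eta^-\mathbf x)$, $\mathbf Y_\xi=\mathrm{diag}(D_\xi^-\mathbf y)$, $\mathbf Y_\eta=\mathrm{diag}(D_\eta^-\mathbf y)$, $\mathbf J=\mathbf X_\xi\mathbf Y_\eta-\mathbf X_\eta\mathbf Y_\xi$ (assumed to have positive diagonal for the $\mathbf p$ considered, an open condition on $\mathbf p$), $\alpha_1=\mathbf J^{-1}(\mathbf X_\eta^2+\mathbf Y_\eta^2)$, $\beta=-\mathbf J^{-1}(\mathbf X_\xi\mathbf X_\eta+\mathbf Y_\xi\mathbf Y_\eta)$, $\alpha_2=\mathbf J^{-1}(\mathbf X_\xi^2+\mathbf Y_\xi^2)$, $\mathbf W_1=\sqrt{\mathbf X_\xi^2+\mathbf Y_\xi^2}$, $\mathbf W_2=\sqrt{\mathbf X_\eta^2+\mathbf Y_\eta^2}$ (elementwise on the diagonals). $D_{\xi\xi}^{(\alpha_1)}$ (resp. $D_{\eta\eta}^{(\alpha_2)}$) is built grid line by grid line in the $\xi$- (resp. $\eta$-) direction from $D_2^{(\mathbf c)}$ with $\mathbf c$ the values of the diagonal of $\alpha_1$ (resp. $\alpha_2$) on that line. Then $D_L^-=\mathbf J^{-1}(D_{\xi\xi}^{(\alpha_1)}+D_\eta^-\beta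 D_\xi^-+D_\xi^-\beta D_\eta^-+D_{\eta\eta}^{(\alpha_2)})$, $d_w^-=-e_w^-\mathbf W_2^{-1}(\alpha_1e_w^{-\top}e_w^-\hat D_\xi^-+\beta e_w^{-\top}e_w^-D_\eta^-)$, $d_e^-=e_e^-\mathbf W_2^{-1}(\alpha_1e_e^{-\top}e_e^-\hat D_\xi^-+\beta e_e^{-\top}e_e^-D_\eta^-)$, $d_s^-=-e_s^-\mathbf W_1^{-1}(\alpha_2e_s^{-\top}e_s^-\hat D_\eta^-+\beta e_s^{-\top}e_s^-D_\xi^-)$, $d_n^-=e_n^-\mathbf W_1^{-1}(\alpha_2e_n^{-\top}e_n^-\hat D_\eta^-+\beta e_n^{-\top}e_n^-D_\xi^-)$ (here $e_k^{-\top}$ is the transpose of $e_k^-$), $H^-=H_\xi^-H_\eta^-\mathbf J$, $H_k^-=He_k^-\mathbf W_2e_k^{-\top}$ for $k=w,e$ and $H_k^-=He_k^-\mathbf W_1e_k^{-\top}$ for $k=s,n$ ($H$ the one-dimensional norm along side $k$). The blocks are conforming at the interface (south side of $\Omega^+$, north side of $\Omega_p^-$), with $H_s^+=H_n^-$. Global operators. $c>0$ is the wave speed, $N=N^++N^-$, $\bar H=\begin{bmatrix}H^+&0\\0&H^-\end{bmatrix}$, $L=\begin{bmatrix}e_n^+&0\\ e_s^+&-e_n^-\end{bmatrix}$, $P=I-\bar H^{-1}L^\top(L\bar H^{-1}L^\top)^{-1}L$, $$D=c^2P\left(\begin{bmatrix}D_L^+&0\\0&D_L^-\end{bmatrix}+SAT_{BC_1}+SAT_{IC}\right)P,\qquad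 E=c\,P\,SAT_{BC_2}P,$$ $$SAT_{BC_1}=-\bar H^{-1}\left(\sum_{k=w,e}\begin{bmatrix}e_k^{+\top}H_k^+d_k^+&0\\0&e_k^{-\top}H_k^-d_k^-\end{bmatrix}+\begin{bmatrix}0&0\\0&e_s^{-\top}H_s^-d_s^-\end{bmatrix}\right),$$ $$SAT_{BC_2}=-\bar H^{-1}\sum_{k=w,e}\begin{bmatrix}e_k^{+\top}H_k^+e_k^+&0\\0&e_k^{-\top}H_k^-e_k^-\end{bmatrix},\qquad SAT_{IC}=-\bar H^{-1}\begin{bmatrix}e_s^{+\top}H_s^+d_s^+&e_s^{+\top}H_s^+d_n^-\\0&0\end{bmatrix}.$$ Source, receiver and loss. $\mathbf d_s=\begin{bmatrix}(H^+)^{-1}(\delta_x^{(s)}\otimes\delta_y^{(s)})\\0\end{bmatrix}$ and $\mathbf d_r=\begin{bmatrix}(H^+)^{-1}(\delta_x^{(r)}\otimes\delta_y^{(r)})\\0\end{bmatrix}$, where $\delta_x^{(s)},\delta_x^{(r)}\in\mathbb R^{m_x^+}$ and $\delta_y^{(s)},\delta_y^{(r)}\in\mathbb R^{m_y^+}$ are fixed discrete one-dimensional point sources (source and receiver lie in $\Omega^+$), so $\mathbf d_s,\mathbf d_r$ do not depend on $\mathbf p$. $f(t)$ (source function) and $\mathbf v_d(t)$ (scalar target data at the receiver) are given (regular) functions on $[0,T]$, independent of $\mathbf p$. The residual is $r(\mathbf w,t)=(\mathbf d_r,\mathbf w(t))_{\bar H}-\mathbf v_d(t)$ and the loss is $$\mathcal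 J(\mathbf w,\mathbf p)=\frac12\int_0^Tr(\mathbf w,t)^2\,dt+\frac12\gamma\|D_2\mathbf p\|_H^2,$$ with $\gamma$ a regularization parameter, and $D_2$, $H$ here the one-dimensional operators on the $m_{\Gamma_I}$ horizontal grid points. *)

theory Defs
  imports "HOL-Analysis.Analysis"
begin

text \<open>
  A set of \<open>m\<close> ordered grid points is an index type \<open>'n\<close> of sort \<open>{finite, linorder}\<close> with
  \<open>CARD('n) = m\<close>. Two-dimensional grid functions are indexed by pairs (horizontal index, vertical
  index), which is the column-major ordering that goes with the Kronecker products below. In
  \<open>rmat\<close> the row index comes first.
\<close>

type_synonym 'n rvec = "real ^ 'n"
type_synonym ('r, 'c) rmat = "real ^ 'c ^ 'r"

section \<open>Matrices\<close>

definition diag :: "'n::finite rvec \<Rightarrow> ('n, 'n) rmat" where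
  "diag v = (\<chi> i j. if i = j then v $ i else 0)"

definition diagonal :: "('n::finite, 'n) rmat \<Rightarrow> 'n rvec" where
  "diagonal A = (\<chi> i. A $ i $ i)"

definition outer :: "'m::finite rvec \<Rightarrow> 'n::finite rvec \<Rightarrow> ('m, 'n) rmat" where
  "outer u v = (\<chi> i j. u $ i * v $ j)"

definition kron :: "('a::finite, 'b::finite) rmat \<Rightarrow> ('c::finite, 'd::finite) rmat \<Rightarrow> ('a \<times> 'c, 'b \<times> 'd) rmat" where
  "kron A B = (\<chi> r s. A $ fst r $ fst s * B $ snd r $ snd s)"

text \<open>
  \<open>v\<^sup>T \<otimes> B\<close> and \<open>A \<otimes> v\<^sup>T\<close> for a row vector \<open>v\<^sup>T\<close>. The rows are indexed by the rows of \<open>B\<close> (of \<open>A\<close>)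
  rather than by their pairs with the single row index of \<open>v\<^sup>T\<close>.
\<close>

definition row_kron :: "'a::finite rvec \<Rightarrow> ('c::finite, 'd::finite) rmat \<Rightarrow> ('c, 'a \<times> 'd) rmat" where
  "row_kron v B = (\<chi> r s. v $ fst s * B $ r $ snd s)"

definition kron_row :: "('a::finite, 'b::finite) rmat \<Rightarrow> 'd::finite rvec \<Rightarrow> ('a, 'b \<times> 'd) rmat" where
  "kron_row A v = (\<chi> r s. A $ r $ fst s * v $ snd s)"

definition kron_vec :: "'a::finite rvec \<Rightarrow> 'b::finite rvec \<Rightarrow> ('a \<times> 'b) rvec" where
  "kron_vec u v = (\<chi> s. u $ fst s * v $ snd s)"

definition block ::
  "('c::finite, 'a::finite) rmat \<Rightarrow> ('c, 'b::finite) rmat \<Rightarrow> ('d::finite, 'a) rmat \<Rightarrow> ('d, 'b) rmat \<Rightarrow> ('c + 'd, 'a + 'b) rmat" where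
  "block A B C D = (\<chi> r s. case r of
       Inl i \<Rightarrow> (case s of Inl j \<Rightarrow> A $ i $ j | Inr j \<Rightarrow> B $ i $ j)
     | Inr i \<Rightarrow> (case s of Inl j \<Rightarrow> C $ i $ j | Inr j \<Rightarrow> D $ i $ j))"

definition block_vec :: "'a::finite rvec \<Rightarrow> 'b::finite rvec \<Rightarrow> ('a + 'b) rvec" where
  "block_vec u v = (\<chi> s. case s of Inl i \<Rightarrow> u $ i | Inr i \<Rightarrow> v $ i)"

definition wprod :: "('n::finite, 'n) rmat \<Rightarrow> 'n rvec \<Rightarrow> 'n rvec \<Rightarrow> real" where
  "wprod A u v = u \<bullet> (A *v v)"

section \<open>One-dimensional SBP operators\<close>

definition e_l :: "'n::{finite, linorder} rvec" where
  "e_l = axis (Min UNIV) 1"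

definition e_r :: "'n::{finite, linorder} rvec" where
  "e_r = axis (Max UNIV) 1"

text \<open>The equidistant grid on \<open>[0, 1]\<close>, with \<open>card {j. j < i}\<close> the zero-based position of \<open>i\<close>.\<close>

definition unit_grid :: "'n::{finite, linorder} \<Rightarrow> real" where
  "unit_grid i = real (card {j. j < i}) / (real CARD('n) - 1)"

record ('n::finite) sbp =
  Hn :: "('n, 'n) rmat"
  D1 :: "('n, 'n) rmat"
  D1hat :: "('n, 'n) rmat"
  Rc :: "'n rvec \<Rightarrow> ('n, 'n) rmat"
  D2c :: "'n rvec \<Rightarrow> ('n, 'n) rmat"

definition d_l :: "'n::{finite, linorder} sbp \<Rightarrow> 'n rvec" where
  "d_l A = e_l v* D1hat A"

definition d_r :: "'n::{finite, linorder} sbp \<Rightarrow> 'n rvec" where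
  "d_r A = e_r v* D1hat A"

definition Mc :: "'n::{finite, linorder} sbp \<Rightarrow> 'n rvec \<Rightarrow> ('n, 'n) rmat" where
  "Mc A c = transpose (D1 A) ** Hn A ** diag c ** D1 A + Rc A c"

definition D2 :: "'n::{finite, linorder} sbp \<Rightarrow> ('n, 'n) rmat" where
  "D2 A = D2c A (\<chi> i. 1)"

definition is_sbp :: "'n::{finite, linorder} sbp \<Rightarrow> bool" where
  "is_sbp A \<longleftrightarrow>
     (\<forall>i j. i \<noteq> j \<longrightarrow> Hn A $ i $ j = 0) \<and> (\<forall>i. 0 < Hn A $ i $ i) \<and>
     Hn A ** D1 A + transpose (D1 A) ** Hn A = - outer e_l e_l + outer e_r e_r \<and>
     linear (Rc A) \<and> (\<forall>c. transpose (Rc A c) = Rc A c) \<and>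
     (\<forall>c. (\<forall>i. 0 \<le> c $ i) \<longrightarrow> (\<forall>u. 0 \<le> u \<bullet> (Rc A c *v u))) \<and>
     (\<forall>c. Hn A ** D2c A c =
        - Mc A c - (e_l \<bullet> c) *\<^sub>R outer e_l (d_l A) + (e_r \<bullet> c) *\<^sub>R outer e_r (d_r A))"

section \<open>The discretisation\<close>

text \<open>
  One-dimensional operators depend on the number of points and on the spacing, so each of the four
  coordinate directions (\<open>x\<close> and \<open>y\<close> in the upper block, \<open>\<xi>\<close> and \<open>\<eta>\<close> in the lower one) has its own.
  The directions \<open>x\<close> and \<open>\<xi>\<close> share the index type \<open>'m\<close>.
\<close>

record ('m::finite, 'n::finite, 'k::finite) disc =
  opx :: "'m sbp"
  opy :: "'n sbp"
  opxi :: "'m sbp"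
  opeta :: "'k sbp"
  x_left :: real
  x_right :: real
  y_interface :: real
  wave_speed :: real

type_synonym ('m, 'n, 'k) su = "('m, 'n, 'k) disc"
type_synonym ('m, 'n, 'k) state = "(('m \<times> 'n) + ('m \<times> 'k)) rvec"
type_synonym ('m, 'n, 'k) gmat =
  "(('m \<times> 'n) + ('m \<times> 'k), ('m \<times> 'n) + ('m \<times> 'k)) rmat"

subsection \<open>Upper block\<close>

context
  fixes S :: "('m::{finite, linorder}, 'n::{finite, linorder}, 'k::{finite, linorder}) disc"
begin

definition DLp :: "('m \<times> 'n, 'm \<times> 'n) rmat" where
  "DLp = kron (D2 (opx S)) (mat 1) + kron (mat 1) (D2 (opy S))"

definition Hp :: "('m \<times> 'n, 'm \<times> 'n) rmat" where
  "Hp = kron (Hn (opx S)) (mat 1) ** kron (mat 1) (Hn (opy S))"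

definition dwp :: "('n, 'm \<times> 'n) rmat" where "dwp = - row_kron (d_l (opx S)) (mat 1)"
definition dep :: "('n, 'm \<times> 'n) rmat" where "dep = row_kron (d_r (opx S)) (mat 1)"
definition dsp :: "('m, 'm \<times> 'n) rmat" where "dsp = - kron_row (mat 1) (d_l (opy S))"
definition dnp :: "('m, 'm \<times> 'n) rmat" where "dnp = kron_row (mat 1) (d_r (opy S))"

definition Hwp :: "('n, 'n) rmat" where "Hwp = Hn (opy S)"
definition Hep :: "('n, 'n) rmat" where "Hep = Hn (opy S)"
definition Hsp :: "('m, 'm) rmat" where "Hsp = Hn (opx S)"
definition Hnp :: "('m, 'm) rmat" where "Hnp = Hn (opx S)"

end

text \<open>The boundary restrictions have the same form in both blocks.\<close>

definition e_w :: "('b, 'a::{finite, linorder} \<times> 'b::{finite, linorder}) rmat" where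
  "e_w = row_kron e_l (mat 1)"
definition e_e :: "('b, 'a::{finite, linorder} \<times> 'b::{finite, linorder}) rmat" where
  "e_e = row_kron e_r (mat 1)"
definition e_s :: "('a, 'a::{finite, linorder} \<times> 'b::{finite, linorder}) rmat" where
  "e_s = kron_row (mat 1) e_l"
definition e_n :: "('a, 'a::{finite, linorder} \<times> 'b::{finite, linorder}) rmat" where
  "e_n = kron_row (mat 1) e_r"

subsection \<open>Lower block\<close>

context
  fixes S :: "('m::{finite, linorder}, 'n::{finite, linorder}, 'k::{finite, linorder}) disc"
begin

definition Dxi :: "('m \<times> 'k, 'm \<times> 'k) rmat" where
  "Dxi = kron (D1 (opxi S)) (mat 1)"
definition Deta :: "('m \<times> 'k, 'm \<times> 'k) rmat" where
  "Deta = kron (mat 1) (D1 (opeta S))"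
definition Dhxi :: "('m \<times> 'k, 'm \<times> 'k) rmat" where
  "Dhxi = kron (D1hat (opxi S)) (mat 1)"
definition Dheta :: "('m \<times> 'k, 'm \<times> 'k) rmat" where
  "Dheta = kron (mat 1) (D1hat (opeta S))"
definition Hxi :: "('m \<times> 'k, 'm \<times> 'k) rmat" where
  "Hxi = kron (Hn (opxi S)) (mat 1)"
definition Heta :: "('m \<times> 'k, 'm \<times> 'k) rmat" where
  "Heta = kron (mat 1) (Hn (opeta S))"

definition xm :: "('m \<times> 'k) rvec" where
  "xm = (\<chi> s. x_left S + (x_right S - x_left S) * unit_grid (fst s))"

definition Xxi :: "('m \<times> 'k, 'm \<times> 'k) rmat" where "Xxi = diag (Dxi *v xm)"
definition Xeta :: "('m \<times> 'k, 'm \<times> 'k) rmat" where "Xeta = diag (Deta *v xm)"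

context
  fixes p :: "'m rvec"
begin

definition ym :: "('m \<times> 'k) rvec" where
  "ym = (\<chi> s. p $ fst s + (y_interface S - p $ fst s) * unit_grid (snd s))"

definition Yxi :: "('m \<times> 'k, 'm \<times> 'k) rmat" where "Yxi = diag (Dxi *v ym)"
definition Yeta :: "('m \<times> 'k, 'm \<times> 'k) rmat" where "Yeta = diag (Deta *v ym)"

definition Jm :: "('m \<times> 'k, 'm \<times> 'k) rmat" where
  "Jm = Xxi ** Yeta - Xeta ** Yxi"

definition admissible :: bool where
  "admissible \<longleftrightarrow> (\<forall>s. 0 < Jm $ s $ s)"

definition alpha1 :: "('m \<times> 'k, 'm \<times> 'k) rmat" where
  "alpha1 = matrix_inv Jm ** (Xeta ** Xeta + Yeta ** Yeta)"
definition beta :: "('m \<times> 'k, 'm \<times> 'k) rmat" where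
  "beta = - (matrix_inv Jm ** (Xxi ** Xeta + Yxi ** Yeta))"
definition alpha2 :: "('m \<times> 'k, 'm \<times> 'k) rmat" where
  "alpha2 = matrix_inv Jm ** (Xxi ** Xxi + Yxi ** Yxi)"

definition W1 :: "('m \<times> 'k, 'm \<times> 'k) rmat" where
  "W1 = diag (\<chi> s. sqrt (diagonal (Xxi ** Xxi + Yxi ** Yxi) $ s))"
definition W2 :: "('m \<times> 'k, 'm \<times> 'k) rmat" where
  "W2 = diag (\<chi> s. sqrt (diagonal (Xeta ** Xeta + Yeta ** Yeta) $ s))"

definition Dxixi :: "('m \<times> 'k, 'm \<times> 'k) rmat" where
  "Dxixi = (\<chi> r s. if snd r = snd s
     then D2c (opxi S) (\<chi> i. diagonal alpha1 $ (i, snd r)) $ fst r $ fst s else 0)"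
definition Detaeta :: "('m \<times> 'k, 'm \<times> 'k) rmat" where
  "Detaeta = (\<chi> r s. if fst r = fst s
     then D2c (opeta S) (\<chi> j. diagonal alpha2 $ (fst r, j)) $ snd r $ snd s else 0)"

definition DLm :: "('m \<times> 'k, 'm \<times> 'k) rmat" where
  "DLm = matrix_inv Jm **
     (Dxixi + Deta ** beta ** Dxi + Dxi ** beta ** Deta + Detaeta)"

definition dwm :: "('k, 'm \<times> 'k) rmat" where
  "dwm = - (e_w ** matrix_inv W2 **
     (alpha1 ** transpose e_w ** e_w ** Dhxi + beta ** transpose e_w ** e_w ** Deta))"
definition dem :: "('k, 'm \<times> 'k) rmat" where
  "dem = e_e ** matrix_inv W2 **
     (alpha1 ** transpose e_e ** e_e ** Dhxi + beta ** transpose e_e ** e_e ** Deta)"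
definition dsm :: "('m, 'm \<times> 'k) rmat" where
  "dsm = - (e_s ** matrix_inv W1 **
     (alpha2 ** transpose e_s ** e_s ** Dheta + beta ** transpose e_s ** e_s ** Dxi))"
definition dnm :: "('m, 'm \<times> 'k) rmat" where
  "dnm = e_n ** matrix_inv W1 **
     (alpha2 ** transpose e_n ** e_n ** Dheta + beta ** transpose e_n ** e_n ** Dxi)"

definition Hm :: "('m \<times> 'k, 'm \<times> 'k) rmat" where
  "Hm = Hxi ** Heta ** Jm"

definition Hwm :: "('k, 'k) rmat" where "Hwm = Hn (opeta S) ** e_w ** W2 ** transpose e_w"
definition Hem :: "('k, 'k) rmat" where "Hem = Hn (opeta S) ** e_e ** W2 ** transpose e_e"
definition Hsm :: "('m, 'm) rmat" where "Hsm = Hn (opxi S) ** e_s ** W1 ** transpose e_s"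
definition Hnm :: "('m, 'm) rmat" where "Hnm = Hn (opxi S) ** e_n ** W1 ** transpose e_n"

subsection \<open>Global operators\<close>

definition Hbar :: "('m, 'n, 'k) gmat" where
  "Hbar = block (Hp S) 0 0 Hm"

definition Lc :: "('m + 'm, ('m \<times> 'n) + ('m \<times> 'k)) rmat" where
  "Lc = block e_n 0 e_s (- e_n)"

definition Pr :: "('m, 'n, 'k) gmat" where
  "Pr = mat 1 - matrix_inv Hbar ** transpose Lc **
     matrix_inv (Lc ** matrix_inv Hbar ** transpose Lc) ** Lc"

definition SAT_BC1 :: "('m, 'n, 'k) gmat" where
  "SAT_BC1 = - (matrix_inv Hbar **
     (block (transpose e_w ** Hwp S ** dwp S) 0 0 (transpose e_w ** Hwm ** dwm)
      + block (transpose e_e ** Hep S ** dep S) 0 0 (transpose e_e ** Hem ** dem)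
      + block 0 0 0 (transpose e_s ** Hsm ** dsm)))"

definition SAT_BC2 :: "('m, 'n, 'k) gmat" where
  "SAT_BC2 = - (matrix_inv Hbar **
     (block (transpose e_w ** Hwp S ** e_w) 0 0 (transpose e_w ** Hwm ** e_w)
      + block (transpose e_e ** Hep S ** e_e) 0 0 (transpose e_e ** Hem ** e_e)))"

definition SAT_IC :: "('m, 'n, 'k) gmat" where
  "SAT_IC = - (matrix_inv Hbar **
     block (transpose e_s ** Hsp S ** dsp S) (transpose e_s ** Hsp S ** dnm) 0 0)"

definition Dop :: "('m, 'n, 'k) gmat" where
  "Dop = (wave_speed S)\<^sup>2 *\<^sub>R (Pr ** (block (DLp S) 0 0 DLm + SAT_BC1 + SAT_IC) ** Pr)"

definition Eop :: "('m, 'n, 'k) gmat" where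
  "Eop = wave_speed S *\<^sub>R (Pr ** SAT_BC2 ** Pr)"

end

subsection \<open>Source, receiver and loss\<close>

text \<open>\<open>d_s\<close> and \<open>d_r\<close> of the source and of the receiver, from their one-dimensional point sources.\<close>

definition point_vec :: "'m rvec \<Rightarrow> 'n rvec \<Rightarrow> ('m, 'n, 'k) state" where
  "point_vec dx dy = block_vec (matrix_inv (Hp S) *v kron_vec dx dy) 0"

definition residual ::
  "('m, 'n, 'k) state \<Rightarrow> (real \<Rightarrow> real) \<Rightarrow> 'm rvec \<Rightarrow> (real \<Rightarrow> ('m, 'n, 'k) state) \<Rightarrow> real \<Rightarrow> real"
  where "residual dr vd p w t = wprod (Hbar p) dr (w t) - vd t"

definition loss ::
  "('m, 'n, 'k) state \<Rightarrow> (real \<Rightarrow> real) \<Rightarrow> real \<Rightarrow> real \<Rightarrow> (real \<Rightarrow> ('m, 'n, 'k) state) \<Rightarrow> 'm rvec \<Rightarrow> real"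
  where "loss dr vd T \<gamma> w p =
    1 / 2 * integral {0..T} (\<lambda>t. (residual dr vd p w t)\<^sup>2)
    + 1 / 2 * \<gamma> * wprod (Hn (opx S)) (D2 (opx S) *v p) (D2 (opx S) *v p)"

definition valid_disc :: bool where
  "valid_disc \<longleftrightarrow> is_sbp (opx S) \<and> is_sbp (opy S) \<and> is_sbp (opxi S) \<and> is_sbp (opeta S) \<and>
     x_left S < x_right S \<and> 0 < wave_speed S"

end

section \<open>Evolution equations and derivatives\<close>

text \<open>
  \<open>u\<close> solves \<open>u'' = A u + B u' + g\<close> on \<open>I \<subseteq> [0, T]\<close> with \<open>u = u' = 0\<close> at \<open>0\<close>, as a classical
  solution that is continuously differentiable on \<open>[0, T]\<close>. Here \<open>v\<close> is \<open>u'\<close>, and derivatives at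
  the end points of \<open>[0, T]\<close> are one-sided.
\<close>

definition solves_ivp ::
  "real \<Rightarrow> real set \<Rightarrow> ('n::finite, 'n) rmat \<Rightarrow> ('n, 'n) rmat \<Rightarrow> (real \<Rightarrow> 'n rvec) \<Rightarrow> (real \<Rightarrow> 'n rvec) \<Rightarrow> bool"
  where "solves_ivp T I A B g u \<longleftrightarrow> (\<exists>v.
     (\<forall>t\<in>{0..T}. (u has_vector_derivative v t) (at t within {0..T})) \<and>
     continuous_on {0..T} v \<and>
     (\<forall>t\<in>I. (v has_vector_derivative A *v u t + B *v v t + g t) (at t within {0..T})) \<and>
     u 0 = 0 \<and> v 0 = 0)"

definition partial :: "'n::finite \<Rightarrow> ('n rvec \<Rightarrow> 'b::real_normed_vector) \<Rightarrow> 'n rvec \<Rightarrow> 'b" where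
  "partial i F p = vector_derivative (\<lambda>s. F (p + s *\<^sub>R axis i 1)) (at 0)"

end

theory Submission
  imports Defs
begin

text \<open>
  The gradient formula is the adjoint-state identity, and it rests on three facts.

  \<^item> At the shape \<open>p\<close>, both \<open>H D\<close> and \<open>H E\<close> are symmetric matrices, with \<open>H\<close> the global norm
    matrix (\<open>symmetric_Dop\<close>, \<open>symmetric_Eop\<close>). In each block, summation by parts writes
    \<open>H D\<^sub>L\<close> as a symmetric matrix plus the boundary terms of its four sides (\<open>upper_block_sbp\<close>,
    \<open>lower_block_sbp\<close>). The penalty terms cancel the western, eastern and southern outer sides; what
    remains on the northern side and at the interface is a left multiple of \<open>L\<^sup>T\<close>, and this is where
    the two interface norms must agree. The projection \<open>P\<close> is self-adjoint in the \<open>H\<close>-inner product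
    and satisfies \<open>L P = 0\<close>, so it annihilates those remaining terms.

  \<^item> \<open>D\<close> and \<open>E\<close> are differentiable functions of the shape (\<open>differentiable_Dop_Eop\<close>): their
    entries arise from affine functions of \<open>p\<close> by sums, products, matrix inverses and square roots of
    positive numbers. Positivity of the Jacobian keeps every inverted matrix invertible and every
    radicand positive, also for nearby shapes.

  \<^item> For self-adjoint coefficients, the adjoint solution turns the residual term of the loss into
    an integral against the source of the perturbation equation (\<open>duality\<close>).

  The derivative (\<open>reduced_gradient\<close>) is obtained without differentiating the forward solution
  with respect to the shape. Let \<open>\<mu>(t) = \<lambda>(T - t)\<close> and let \<open>w\<^sub>q\<close> be the solution for the shape
  \<open>q\<close>. The difference \<open>w\<^sub>q - w\<^sub>p\<close> solves the equation with the coefficients of \<open>p\<close> and the source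
  \<open>(D\<^sub>q - D\<^sub>p) w\<^sub>q + (E\<^sub>q - E\<^sub>p) w\<^sub>q'\<close>. Duality therefore gives, for the misfit part \<open>J\<close> of the loss,
  \<open>J(q) - J(p) = - \<integral> (\<mu>, (D\<^sub>q - D\<^sub>p) w\<^sub>q + (E\<^sub>q - E\<^sub>p) w\<^sub>q')\<^sub>H + 1/2 \<integral> (d, w\<^sub>q - w\<^sub>p)\<^sub>H\<^sup>2\<close>.
  Gronwall's inequality bounds \<open>w\<^sub>q - w\<^sub>p\<close> and its velocity by a multiple of \<open>|q - p|\<close>
  (\<open>solution_pair_bound\<close>), so replacing \<open>w\<^sub>q\<close> by \<open>w\<^sub>p\<close> and dropping the last integral costs only a
  term of order \<open>|q - p|\<^sup>2\<close>. What is left is a fixed linear functional of \<open>D\<^sub>q - D\<^sub>p\<close> and \<open>E\<^sub>q - E\<^sub>p\<close>,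
  to which the chain rule applies. An integration by parts in time moves the time derivative from
  \<open>w\<^sub>p\<close> to \<open>\<mu>\<close> in the \<open>E\<close> term.
\<close>

section \<open>Differentiable families of matrices\<close>

lemma matrix_inv_eqI:
  fixes A :: "real^'n^'n"
  assumes "A ** B = mat 1"
  shows "matrix_inv A = B"
proof -
  have BA: "B ** A = mat 1"
    using assms by (simp add: matrix_left_right_inverse)
  have ex: "A ** matrix_inv A = mat 1 \<and> matrix_inv A ** A = mat 1"
    unfolding matrix_inv_def by (rule someI[of _ B]) (simp add: assms BA)
  have "matrix_inv A = B ** A ** matrix_inv A" by (simp add: BA)
  also have "\<dots> = B" using ex by (simp flip: matrix_mul_assoc)
  finally show ?thesis .
qed

lemma matrix_inv_mult:
  fixes A :: "real^'n^'n"
  assumes "invertible A"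
  shows "A ** matrix_inv A = mat 1" "matrix_inv A ** A = mat 1"
proof -
  obtain B where B: "A ** B = mat 1" "B ** A = mat 1"
    using assms unfolding invertible_def by blast
  then show "A ** matrix_inv A = mat 1" "matrix_inv A ** A = mat 1"
    by (simp_all add: matrix_inv_eqI[OF B(1)])
qed

text \<open>
  Cramer's rule, column by column. It shows that the entries of the inverse depend on those of the
  matrix through determinants only, which is what makes \<open>matrix_inv\<close> differentiable.
\<close>

lemma matrix_inv_cramer:
  fixes A :: "real^'n^'n"
  assumes "det A \<noteq> 0"
  shows "matrix_inv A = (\<chi> k l. det (\<chi> i j. if j = k then mat 1 $ i $ l else A $ i $ j) / det A)"
    (is "_ = ?B")
proof (rule matrix_inv_eqI)
  have "A *v column l ?B = column l (mat 1)" for l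
    unfolding cramer[OF assms] by (simp add: column_def cong: if_cong)
  then show "A ** ?B = mat 1"
    by (simp add: vec_eq_iff matrix_matrix_mult_def matrix_vector_mult_def column_def)
qed

lemma differentiable_vec_iff:
  fixes F :: "'a::real_normed_vector \<Rightarrow> 'b::euclidean_space ^ 'n"
  shows "F differentiable (at x) \<longleftrightarrow> (\<forall>i. (\<lambda>q. F q $ i) differentiable (at x))"
proof
  assume "F differentiable (at x)"
  then obtain F' where "(F has_derivative F') (at x)"
    by (auto simp: differentiable_def)
  then have "((\<lambda>q. F q $ i) has_derivative (\<lambda>h. F' h $ i)) (at x)" for i
    by (rule bounded_linear.has_derivative[OF bounded_linear_vec_nth])
  then show "\<forall>i. (\<lambda>q. F q $ i) differentiable (at x)"
    unfolding differentiable_def by blast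
next
  assume *: "\<forall>i. (\<lambda>q. F q $ i) differentiable (at x)"
  have lin: "bounded_linear (axis i :: 'b \<Rightarrow> 'b ^ 'n)" for i
    unfolding linear_conv_bounded_linear[symmetric]
    by (auto intro!: linearI simp: vec_eq_iff axis_def)
  have "(\<lambda>q. axis i (F q $ i)) differentiable (at x)" for i
  proof -
    obtain F' where "((\<lambda>q. F q $ i) has_derivative F') (at x)"
      using * by (auto simp: differentiable_def)
    from bounded_linear.has_derivative[OF lin this] show ?thesis
      by (rule differentiableI)
  qed
  then have "(\<lambda>q. \<Sum>i\<in>UNIV. axis i (F q $ i)) differentiable (at x)"
    by (intro differentiable_sum) auto
  moreover have "(\<Sum>i\<in>UNIV. axis i (F q $ i)) = F q" for q
    by (simp add: vec_eq_iff axis_def)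
  ultimately show "F differentiable (at x)" by simp
qed

lemma differentiable_matrix_iff:
  fixes F :: "'a::real_normed_vector \<Rightarrow> ('r::finite, 'c::finite) rmat"
  shows "F differentiable (at x) \<longleftrightarrow> (\<forall>i j. (\<lambda>q. F q $ i $ j) differentiable (at x))"
  by (simp add: differentiable_vec_iff)

lemma differentiable_vec_nth [derivative_intros]:
  fixes F :: "'a::real_normed_vector \<Rightarrow> real^'n"
  shows "F differentiable (at x) \<Longrightarrow> (\<lambda>q. F q $ i) differentiable (at x)"
  by (simp add: differentiable_vec_iff)

lemma differentiable_matrix_nth:
  fixes F :: "'a::real_normed_vector \<Rightarrow> ('r::finite, 'c::finite) rmat"
  shows "F differentiable (at x) \<Longrightarrow> (\<lambda>q. F q $ i $ j) differentiable (at x)"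
  by (simp add: differentiable_matrix_iff)

lemma differentiable_matrix_mult:
  fixes F :: "'a::real_normed_vector \<Rightarrow> ('r::finite, 'k::finite) rmat"
    and G :: "'a \<Rightarrow> ('k, 'c::finite) rmat"
  assumes "F differentiable (at x)" "G differentiable (at x)"
  shows "(\<lambda>q. F q ** G q) differentiable (at x)"
  using assms unfolding differentiable_matrix_iff
  by (auto simp: matrix_matrix_mult_def intro!: differentiable_sum differentiable_mult)

lemma differentiable_diag:
  fixes v :: "'a::real_normed_vector \<Rightarrow> real^'n"
  assumes "\<And>i. (\<lambda>q. v q $ i) differentiable (at x)"
  shows "(\<lambda>q. diag (v q)) differentiable (at x)"
  unfolding differentiable_matrix_iff
proof (intro allI)
  fix i j
  show "(\<lambda>q. diag (v q) $ i $ j) differentiable (at x)"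
    using assms by (cases "i = j") (simp_all add: diag_def)
qed

lemma differentiable_block:
  fixes A :: "'a::real_normed_vector \<Rightarrow> ('r::finite, 'c::finite) rmat"
    and B :: "'a \<Rightarrow> ('r, 'd::finite) rmat"
    and C :: "'a \<Rightarrow> ('s::finite, 'c) rmat"
    and D :: "'a \<Rightarrow> ('s, 'd) rmat"
  assumes "A differentiable (at x)" "B differentiable (at x)"
    "C differentiable (at x)" "D differentiable (at x)"
  shows "(\<lambda>q. block (A q) (B q) (C q) (D q)) differentiable (at x)"
  unfolding differentiable_matrix_iff
proof (intro allI)
  fix i j
  show "(\<lambda>q. block (A q) (B q) (C q) (D q) $ i $ j) differentiable (at x)"
    using assms by (cases i; cases j) (simp_all add: block_def differentiable_matrix_iff)
qed

lemma differentiable_prod: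
  fixes f :: "'i \<Rightarrow> 'a::real_normed_vector \<Rightarrow> real"
  assumes "\<And>i. i \<in> I \<Longrightarrow> f i differentiable (at x)"
  shows "(\<lambda>q. \<Prod>i\<in>I. f i q) differentiable (at x)"
proof -
  from assms have "\<forall>i\<in>I. \<exists>f'. (f i has_derivative f') (at x)"
    by (auto simp: differentiable_def)
  then obtain f' where "\<And>i. i \<in> I \<Longrightarrow> (f i has_derivative f' i) (at x)"
    by metis
  then have "((\<lambda>q. \<Prod>i\<in>I. f i q) has_derivative
      (\<lambda>y. \<Sum>i\<in>I. f' i y * (\<Prod>j\<in>I - {i}. f j x))) (at x)"
    by (rule has_derivative_prod)
  then show ?thesis by (rule differentiableI)
qed

lemma differentiable_det:
  fixes F :: "'a::real_normed_vector \<Rightarrow> ('n::finite, 'n) rmat"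
  assumes "F differentiable (at x)"
  shows "(\<lambda>q. det (F q)) differentiable (at x)"
  using assms unfolding det_def differentiable_matrix_iff
  by (intro differentiable_sum ballI differentiable_mult differentiable_const
      differentiable_prod) auto

text \<open>
  Invertibility at the one point \<open>x\<close> suffices, because the determinant is continuous and so Cramer's
  formula is valid in a whole neighbourhood of \<open>x\<close>.
\<close>

lemma differentiable_matrix_inv:
  fixes F :: "'a::real_normed_vector \<Rightarrow> ('n::finite, 'n) rmat"
  assumes F: "F differentiable (at x)" and inv: "invertible (F x)"
  shows "(\<lambda>q. matrix_inv (F q)) differentiable (at x)"
proof -
  let ?C = "\<lambda>q. \<chi> k l. det (\<chi> i j. if j = k then mat 1 $ i $ l else F q $ i $ j) / det (F q)"
  have dF: "(\<lambda>q. det (F q)) differentiable (at x)"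
    by (rule differentiable_det[OF F])
  have nz: "det (F x) \<noteq> 0"
    using inv by (simp add: invertible_det_nz)
  have cof: "(\<lambda>q. det (\<chi> i j. if j = k then mat 1 $ i $ l else F q $ i $ j)) differentiable (at x)"
    for k l :: 'n
  proof (rule differentiable_det, unfold differentiable_matrix_iff, intro allI)
    fix i j
    show "(\<lambda>q. (\<chi> i j. if j = k then mat 1 $ i $ l else F q $ i $ j) $ i $ j) differentiable (at x)"
      using F by (cases "j = k") (simp_all add: differentiable_matrix_iff)
  qed
  have C: "?C differentiable (at x)"
    unfolding differentiable_matrix_iff using dF nz cof by (auto intro!: differentiable_divide)
  have "isCont (\<lambda>q. det (F q)) x"
    by (rule differentiable_imp_continuous_within[OF dF])
  then have ev: "\<forall>\<^sub>F q in at x. det (F q) \<noteq> 0"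
    using nz by (auto simp: isCont_def intro: tendsto_imp_eventually_ne)
  obtain C' where "(?C has_derivative C') (at x)"
    using C by (auto simp: differentiable_def)
  then have "((\<lambda>q. matrix_inv (F q)) has_derivative C') (at x)"
  proof (rule has_derivative_transform_eventually)
    show "\<forall>\<^sub>F q in at x. ?C q = matrix_inv (F q)"
      by (rule eventually_mono[OF ev]) (simp add: matrix_inv_cramer)
  qed (simp_all add: matrix_inv_cramer[OF nz])
  then show ?thesis by (auto simp: differentiable_def)
qed

lemma differentiable_sqrt:
  fixes f :: "'a::real_normed_vector \<Rightarrow> real"
  assumes "f differentiable (at x)" "0 < f x"
  shows "(\<lambda>q. sqrt (f q)) differentiable (at x)"
proof -
  have "sqrt differentiable (at (f x))"
    using assms(2) DERIV_real_sqrt[of "f x"] by (auto simp: real_differentiable_def)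
  then show ?thesis by (rule differentiable_compose) (rule assms(1))
qed

section \<open>Diagonal matrices\<close>

lemma diag_mult_nth [simp]: "(diag v ** A) $ i $ j = v $ i * A $ i $ j"
  by (simp add: matrix_matrix_mult_def diag_def if_distrib if_distribR cong: if_cong)

lemma mult_diag_nth [simp]: "(A ** diag v) $ i $ j = A $ i $ j * v $ j"
  by (simp add: matrix_matrix_mult_def diag_def if_distrib if_distribR cong: if_cong)

lemma diag_mult_diag: "diag u ** diag v = diag (\<chi> i. u $ i * v $ i)"
  unfolding vec_eq_iff by (auto simp: diag_def mult_diag_nth[unfolded diag_def])

lemma diag_nth: "diag v $ i $ j = (if i = j then v $ i else 0)"
  by (simp add: diag_def)

lemma transpose_diag [simp]: "transpose (diag v) = diag v"
  by (auto simp: vec_eq_iff diag_def transpose_def)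

lemma diag_mult_diag_inverse:
  assumes "\<And>i. v $ i \<noteq> 0"
  shows "diag v ** diag (\<chi> i. inverse (v $ i)) = mat 1"
  unfolding diag_mult_diag using assms by (auto simp: vec_eq_iff diag_def mat_def)

lemma matrix_inv_diag:
  assumes "\<And>i. v $ i \<noteq> 0"
  shows "matrix_inv (diag v) = diag (\<chi> i. inverse (v $ i))"
  by (rule matrix_inv_eqI) (rule diag_mult_diag_inverse[OF assms])

lemma invertible_diag:
  assumes "\<And>i. v $ i \<noteq> 0"
  shows "invertible (diag v)"
  using diag_mult_diag_inverse[OF assms] by (auto simp: invertible_right_inverse)

text \<open>
  Most matrices of the discretisation are diagonal. A predicate that is closed under the matrix
  operations is easier to propagate through their definitions than explicit diagonals.
\<close>

definition is_diag :: "('n::finite, 'n) rmat \<Rightarrow> bool" where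
  "is_diag A \<longleftrightarrow> (\<forall>i j. i \<noteq> j \<longrightarrow> A $ i $ j = 0)"

lemma is_diag_eq: "is_diag A \<Longrightarrow> A = diag (diagonal A)"
  by (auto simp: is_diag_def diag_def diagonal_def vec_eq_iff)

lemma is_diag_diag [simp]: "is_diag (diag v)"
  by (simp add: is_diag_def diag_def)

lemma is_diag_mult_nth: "is_diag A \<Longrightarrow> (A ** B) $ i $ j = A $ i $ i * B $ i $ j"
  by (subst is_diag_eq) (auto simp: diagonal_def)

lemma is_diag_mult [intro]: "is_diag A \<Longrightarrow> is_diag B \<Longrightarrow> is_diag (A ** B)"
  using is_diag_mult_nth[of A B] unfolding is_diag_def by auto

lemma is_diag_add [intro]: "is_diag A \<Longrightarrow> is_diag B \<Longrightarrow> is_diag (A + B)"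
  unfolding is_diag_def by auto

lemma is_diag_diff [intro]: "is_diag A \<Longrightarrow> is_diag B \<Longrightarrow> is_diag (A - B)"
  unfolding is_diag_def by auto

lemma is_diag_uminus [intro]: "is_diag A \<Longrightarrow> is_diag (- A)"
  unfolding is_diag_def by auto

lemma is_diag_transpose: "is_diag A \<Longrightarrow> transpose A = A"
  by (metis is_diag_eq transpose_diag)

lemma is_diag_invertible:
  assumes "is_diag A" "\<And>i. A $ i $ i \<noteq> 0"
  shows "invertible A"
  by (subst is_diag_eq[OF assms(1)], rule invertible_diag) (simp add: diagonal_def assms(2))

lemma is_diag_matrix_inv:
  assumes "is_diag A" "\<And>i. A $ i $ i \<noteq> 0"
  shows "is_diag (matrix_inv A)" "matrix_inv A $ i $ i = inverse (A $ i $ i)"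
proof -
  have "matrix_inv A = diag (\<chi> i. inverse (diagonal A $ i))"
    by (subst is_diag_eq[OF assms(1)], rule matrix_inv_diag) (simp add: diagonal_def assms(2))
  then show "is_diag (matrix_inv A)" "matrix_inv A $ i $ i = inverse (A $ i $ i)"
    by (simp_all add: diagonal_def diag_nth)
qed

lemma mult_delta_left: "(if b then x else 0) * y = (if b then x * y else (0::real))"
  and mult_delta_right: "x * (if b then y else 0) = (if b then x * y else (0::real))"
  by simp_all

lemma sum_if_const: "(\<Sum>b\<in>B. if P then f b else 0) = (if P then \<Sum>b\<in>B. f b else (0::real))"
  by simp

section \<open>Kronecker products and block matrices\<close>

lemma sum_UNIV_prod: "(\<Sum>s\<in>UNIV. f s) = (\<Sum>a\<in>UNIV. \<Sum>b\<in>UNIV. f (a, b))"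
  for f :: "'a::finite \<times> 'b::finite \<Rightarrow> real"
  by (simp add: sum.cartesian_product flip: UNIV_Times_UNIV)

lemma sum_UNIV_sum: "(\<Sum>s\<in>UNIV. f s) = (\<Sum>a\<in>UNIV. f (Inl a)) + (\<Sum>b\<in>UNIV. f (Inr b))"
  for f :: "'a::finite + 'b::finite \<Rightarrow> real"
  unfolding UNIV_sum by (subst sum.union_disjoint) (auto simp: sum.reindex)

lemma kron_mult: "kron A B ** kron C D = kron (A ** C) (B ** D)"
  by (simp add: vec_eq_iff kron_def matrix_matrix_mult_def sum_UNIV_prod sum_product ac_simps)

lemma transpose_kron: "transpose (kron A B) = kron (transpose A) (transpose B)"
  by (simp add: vec_eq_iff kron_def transpose_def)

lemma kron_add_left: "kron (A + B) C = kron A C + kron B C"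
  and kron_add_right: "kron C (A + B) = kron C A + kron C B"
  and kron_diff_left: "kron (A - B) C = kron A C - kron B C"
  and kron_diff_right: "kron C (A - B) = kron C A - kron C B"
  and kron_minus_left: "kron (- A) C = - kron A C"
  and kron_minus_right: "kron C (- A) = - kron C A"
  by (simp_all add: vec_eq_iff kron_def algebra_simps)

lemma is_diag_kron: "is_diag A \<Longrightarrow> is_diag B \<Longrightarrow> is_diag (kron A B)"
  by (auto simp: is_diag_def kron_def prod_eq_iff)

lemma is_diag_mat [simp]: "is_diag (mat 1)"
  by (simp add: is_diag_def mat_def)

text \<open>
  Restriction to a side, a matrix along that side, and a derivative in the other direction combine
  to a Kronecker product: this is how boundary terms are compared with the operators inside a block.
\<close>

lemma row_kron_normal:
  "transpose (row_kron u (mat 1)) ** A ** row_kron v (mat 1) = kron (outer u v) A"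
  by (simp add: vec_eq_iff row_kron_def transpose_def matrix_matrix_mult_def kron_def outer_def
      mat_def mult_delta_left mult_delta_right sum_if_const cong: if_cong)

lemma kron_row_normal:
  "transpose (kron_row (mat 1) u) ** A ** kron_row (mat 1) v = kron A (outer u v)"
  by (simp add: vec_eq_iff kron_row_def transpose_def matrix_matrix_mult_def kron_def outer_def
      mat_def mult_delta_left mult_delta_right sum_if_const cong: if_cong)

lemma row_kron_kron: "row_kron u (mat 1) ** kron (mat 1) A = A ** row_kron u (mat 1)"
  by (simp add: vec_eq_iff row_kron_def matrix_matrix_mult_def kron_def sum_UNIV_prod
      mat_def axis_def mult_delta_left mult_delta_right sum_if_const cong: if_cong)

lemma kron_row_kron: "kron_row (mat 1) u ** kron A (mat 1) = A ** kron_row (mat 1) u"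
  by (simp add: vec_eq_iff kron_row_def matrix_matrix_mult_def kron_def sum_UNIV_prod
      mat_def axis_def mult_delta_left mult_delta_right sum_if_const cong: if_cong)

lemma row_kron_orthonormal:
  "row_kron (axis i 1) (mat 1) ** transpose (row_kron (axis i 1) (mat 1)) = mat 1"
  by (simp add: vec_eq_iff row_kron_def matrix_matrix_mult_def transpose_def sum_UNIV_prod
      mat_def axis_def mult_delta_left mult_delta_right sum_if_const cong: if_cong)

lemma kron_row_orthonormal:
  "kron_row (mat 1) (axis i 1) ** transpose (kron_row (mat 1) (axis i 1)) = mat 1"
  by (simp add: vec_eq_iff kron_row_def matrix_matrix_mult_def transpose_def sum_UNIV_prod
      mat_def axis_def mult_delta_left mult_delta_right sum_if_const cong: if_cong)

lemma block_mult:
  "block A B C D ** block A' B' C' D' =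
   block (A ** A' + B ** C') (A ** B' + B ** D') (C ** A' + D ** C') (C ** B' + D ** D')"
  by (auto simp: vec_eq_iff block_def matrix_matrix_mult_def sum_UNIV_sum split: sum.split)

lemma transpose_block:
  "transpose (block A B C D) = block (transpose A) (transpose C) (transpose B) (transpose D)"
  by (auto simp: vec_eq_iff block_def transpose_def split: sum.split)

lemma block_add: "block A B C D + block A' B' C' D' = block (A + A') (B + B') (C + C') (D + D')"
  and block_minus: "- block A B C D = block (- A) (- B) (- C) (- D)"
  by (auto simp: vec_eq_iff block_def split: sum.split)

lemma block_mat: "block (mat 1) 0 0 (mat 1) = mat 1"
  by (auto simp: vec_eq_iff block_def mat_def split: sum.split)

lemma block_mult_vec: "block A B C D *v block_vec u v = block_vec (A *v u + B *v v) (C *v u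
    + D *v v)"
  by (auto simp: vec_eq_iff block_def block_vec_def matrix_vector_mult_def sum_UNIV_sum split:
      sum.split)

lemma inner_block_vec: "block_vec u v \<bullet> block_vec u' v' = u \<bullet> u' + v \<bullet> v'"
  by (simp add: inner_vec_def block_vec_def sum_UNIV_sum)

lemma block_vec_cases: obtains a b where "x = block_vec a b"
proof
  show "x = block_vec (\<chi> i. x $ Inl i) (\<chi> i. x $ Inr i)"
    by (auto simp: vec_eq_iff block_vec_def split: sum.split)
qed

lemma matrix_minus_mult: "(- A) ** B = - (A ** B)" "A ** (- B) = - (A ** B)"
  for A :: "('r::finite, 'k::finite) rmat" and B :: "('k, 'c::finite) rmat"
  by (simp_all add: vec_eq_iff matrix_matrix_mult_def sum_negf)

lemma matrix_diff_mult: "(A - A') ** B = A ** B - A' ** B" "A ** (B - B') = A ** B - A ** B'"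
  for A A' :: "('r::finite, 'k::finite) rmat" and B B' :: "('k, 'c::finite) rmat"
  by (simp_all add: vec_eq_iff matrix_matrix_mult_def sum_subtractf algebra_simps)

lemma matrix_add_mult: "(A + A') ** B = A ** B + A' ** B"
  for A A' :: "('r::finite, 'k::finite) rmat" and B :: "('k, 'c::finite) rmat"
  by (simp add: vec_eq_iff matrix_matrix_mult_def sum.distrib algebra_simps)

lemma transpose_add: "transpose (A + B) = transpose A + transpose B"
  and transpose_diff: "transpose (A - B) = transpose A - transpose B"
  and transpose_minus: "transpose (- A) = - transpose A"
  and transpose_zero: "transpose 0 = 0"
  for A B :: "('r::finite, 'c::finite) rmat"
  by (simp_all add: vec_eq_iff transpose_def)

lemma transpose_congruence:
  fixes A :: "('n::finite, 'n) rmat" and X :: "('n, 'k::finite) rmat"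
  shows "transpose A = A \<Longrightarrow> transpose (transpose X ** A ** X) = transpose X ** A ** X"
  by (simp add: matrix_transpose_mul matrix_mul_assoc)

section \<open>One-dimensional operators\<close>

lemma sbp_Hn:
  assumes "is_sbp A"
  shows "is_diag (Hn A)" "0 < Hn A $ i $ i"
  using assms by (auto simp: is_sbp_def is_diag_def)

lemma sbp_D1:
  assumes "is_sbp A"
  shows "Hn A ** D1 A = - (transpose (D1 A) ** Hn A) - outer e_l e_l + outer e_r e_r"
  using assms unfolding is_sbp_def by (simp add: algebra_simps eq_diff_eq)

lemma transpose_Mc:
  assumes "is_sbp A"
  shows "transpose (Mc A c) = Mc A c"
proof -
  have "transpose (Hn A ** diag c) = Hn A ** diag c"
    using sbp_Hn[OF assms] by (intro is_diag_transpose) auto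
  then have "transpose (transpose (D1 A) ** (Hn A ** diag c) ** D1 A)
      = transpose (D1 A) ** (Hn A ** diag c) ** D1 A"
    by (rule transpose_congruence)
  then show ?thesis
    using assms by (simp add: Mc_def transpose_add is_sbp_def matrix_mul_assoc)
qed

lemma sbp_D2c:
  assumes "is_sbp A"
  shows "Hn A ** D2c A c = - Mc A c - (e_l \<bullet> c) *\<^sub>R outer e_l (d_l A)
      + (e_r \<bullet> c) *\<^sub>R outer e_r (d_r A)"
  using assms unfolding is_sbp_def by blast

lemma d_l_nth: "d_l A $ k = D1hat A $ Min UNIV $ k"
  and d_r_nth: "d_r A $ k = D1hat A $ Max UNIV $ k"
  by (simp_all add: d_l_def d_r_def e_l_def e_r_def vector_matrix_mult_def axis_def
      mult_delta_left mult_delta_right cong: if_cong)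

lemma e_l_inner: "e_l \<bullet> c = c $ Min UNIV"
  and e_r_inner: "e_r \<bullet> c = c $ Max UNIV"
  by (simp_all add: e_l_def e_r_def inner_axis')

lemma e_l_nth: "e_l $ i = (if i = Min UNIV then 1 else 0)"
  and e_r_nth: "e_r $ i = (if i = Max UNIV then 1 else 0)"
  by (simp_all add: e_l_def e_r_def axis_def)

text \<open>
  Since the norm matrix is diagonal, the defining identity of the second derivative can be read off
  row by row. The coefficient enters the boundary part only through its value in the same row, which
  is why the boundary terms of all grid lines can later be collected into one diagonal coefficient.
\<close>

lemma sbp_D2c_nth:
  assumes "is_sbp A"
  shows "Hn A $ i $ i * D2c A c $ i $ k = - Mc A c $ i $ k
    + ((if i = Max UNIV then 1 else 0) - (if i = Min UNIV then 1 else 0)) * c $ i * D1hat A $ i $ k"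
proof -
  have "(Hn A ** D2c A c) $ i $ k = Hn A $ i $ i * D2c A c $ i $ k"
    by (rule is_diag_mult_nth[OF sbp_Hn(1)[OF assms]])
  then show ?thesis
    unfolding sbp_D2c[OF assms]
    by (auto simp: outer_def d_l_nth d_r_nth e_l_nth e_r_nth e_l_inner e_r_inner algebra_simps)
qed

text \<open>
  \<open>D\<^sub>2\<^bsup>(c)\<^esup>\<close> depends on \<open>c\<close> linearly, because \<open>R\<^bsup>(c)\<^esup>\<close> does and the norm matrix is invertible.
\<close>

lemma differentiable_D2c:
  fixes c :: "'a::real_normed_vector \<Rightarrow> 'n::{finite, linorder} rvec"
  assumes A: "is_sbp A" and c: "c differentiable (at x)"
  shows "(\<lambda>q. D2c A (c q)) differentiable (at x)"
proof -
  have "linear (Rc A)"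
    using A by (simp add: is_sbp_def)
  then have R: "(\<lambda>q. Rc A (c q)) differentiable (at x)"
    using c linear_imp_differentiable differentiable_compose by blast
  have M: "(\<lambda>q. Mc A (c q)) differentiable (at x)"
    unfolding Mc_def using R c
    by (intro differentiable_add differentiable_matrix_mult differentiable_diag differentiable_const
        differentiable_vec_nth)
  have "\<And>q i k. D2c A (c q) $ i $ k = (- Mc A (c q) $ i $ k
    + ((if i = Max UNIV then 1 else 0) - (if i
        = Min UNIV then 1 else 0)) * c q $ i * D1hat A $ i $ k)
     / Hn A $ i $ i"
    using sbp_D2c_nth[OF A] sbp_Hn(2)[OF A]
    by (metis less_numeral_extra(3) nonzero_mult_div_cancel_left)
  moreover have "(\<lambda>q. (- Mc A (c q) $ i $ k + z * c q $ i * D1hat A $ i $ k) / Hn A $ i $ i)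
      differentiable (at x)" for i k z
    using sbp_Hn(2)[OF A, of i] M c
    by (intro differentiable_divide differentiable_add differentiable_minus differentiable_mult
        differentiable_const differentiable_vec_nth differentiable_matrix_nth) auto
  ultimately show ?thesis
    unfolding differentiable_matrix_iff by presburger
qed

section \<open>Summation by parts in the upper block\<close>

text \<open>
  Green's identity on the rectangle: each one-dimensional operator contributes a symmetric matrix
  and its two end points, tensored with the norm matrix of the other direction.
\<close>

lemma upper_block_sbp:
  fixes S :: "('m::{finite, linorder}, 'n::{finite, linorder}, 'k::{finite, linorder}) disc"
  assumes S: "valid_disc S"
  obtains M where "transpose M = M"
    "Hp S ** DLp S = - M + transpose e_w ** Hwp S ** dwp S + transpose e_e ** Hep S ** dep S
       + transpose e_s ** Hsp S ** dsp S + transpose e_n ** Hnp S ** dnp S"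
proof
  define Mx My where "Mx = Mc (opx S) (\<chi> i. 1)" and "My = Mc (opy S) (\<chi> i. 1)"
  let ?Hx = "Hn (opx S)" and ?Hy = "Hn (opy S)"
  let ?M = "kron Mx ?Hy + kron ?Hx My"
  have x: "is_sbp (opx S)" and y: "is_sbp (opy S)"
    using S by (simp_all add: valid_disc_def)
  have one: "e_l \<bullet> (\<chi> i. 1) = (1::real)" "e_r \<bullet> (\<chi> i. 1) = (1::real)"
    by (simp_all add: e_l_inner e_r_inner)
  show "transpose ?M = ?M"
    unfolding transpose_add transpose_kron Mx_def My_def transpose_Mc[OF x] transpose_Mc[OF y]
    by (simp add: is_diag_transpose sbp_Hn(1) x y)
  have "Hp S ** DLp S = kron (?Hx ** D2 (opx S)) ?Hy + kron ?Hx (?Hy ** D2 (opy S))"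
    by (simp add: Hp_def DLp_def kron_mult matrix_add_ldistrib)
  also have "?Hx ** D2 (opx S) = - Mx - outer e_l (d_l (opx S)) + outer e_r (d_r (opx S))"
    by (simp add: D2_def sbp_D2c[OF x] one Mx_def)
  also have "?Hy ** D2 (opy S) = - My - outer e_l (d_l (opy S)) + outer e_r (d_r (opy S))"
    by (simp add: D2_def sbp_D2c[OF y] one My_def)
  finally show "Hp S ** DLp S = - ?M + transpose e_w ** Hwp S ** dwp S
      + transpose e_e ** Hep S ** dep S
       + transpose e_s ** Hsp S ** dsp S + transpose e_n ** Hnp S ** dnp S"
    by (simp add: dwp_def dep_def dsp_def dnp_def e_w_def e_e_def e_s_def e_n_def Hwp_def Hep_def
        Hsp_def Hnp_def matrix_minus_mult row_kron_normal kron_row_normal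
        kron_add_left kron_add_right kron_diff_left kron_diff_right kron_minus_left
            kron_minus_right)
qed

section \<open>Summation by parts in the lower block\<close>

lemma is_diag_lower:
  fixes S :: "('m::{finite, linorder}, 'n::{finite, linorder}, 'k::{finite, linorder}) disc"
  shows "is_diag (Xxi S)" "is_diag (Xeta S)" "is_diag (Yxi S p)" "is_diag (Yeta S p)"
    "is_diag (Jm S p)" "is_diag (W1 S p)" "is_diag (W2 S p)"
proof -
  show *: "is_diag (Xxi S)" "is_diag (Xeta S)" "is_diag (Yxi S p)" "is_diag (Yeta S p)"
    "is_diag (W1 S p)" "is_diag (W2 S p)"
    by (simp_all add: Xxi_def Xeta_def Yxi_def Yeta_def W1_def W2_def)
  show "is_diag (Jm S p)"
    unfolding Jm_def using * by blast
qed

lemma Jm_nth: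
  "Jm S p $ s $ s = Xxi S $ s $ s * Yeta S p $ s $ s - Xeta S $ s $ s * Yxi S p $ s $ s"
  by (simp add: Jm_def is_diag_mult_nth is_diag_lower)

lemma W_nth:
  "W1 S p $ s $ s = sqrt ((Xxi S $ s $ s)\<^sup>2 + (Yxi S p $ s $ s)\<^sup>2)"
  "W2 S p $ s $ s = sqrt ((Xeta S $ s $ s)\<^sup>2 + (Yeta S p $ s $ s)\<^sup>2)"
  by (simp_all add: W1_def W2_def diag_nth diagonal_def is_diag_mult_nth is_diag_lower
      power2_eq_square)

text \<open>
  The Jacobian is a \<open>2 \<times> 2\<close> determinant with rows \<open>(X\<^sub>\<xi>, X\<^sub>\<eta>)\<close> and \<open>(Y\<^sub>\<xi>, Y\<^sub>\<eta>)\<close>, so it can only be positive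
  if neither column vanishes.
\<close>

lemma admissible_metric_pos:
  assumes "admissible S p"
  shows "0 < (Xxi S $ s $ s)\<^sup>2 + (Yxi S p $ s $ s)\<^sup>2"
    "0 < (Xeta S $ s $ s)\<^sup>2 + (Yeta S p $ s $ s)\<^sup>2"
proof -
  have "0 < Xxi S $ s $ s * Yeta S p $ s $ s - Xeta S $ s $ s * Yxi S p $ s $ s"
    using assms unfolding admissible_def Jm_nth by blast
  then show "0 < (Xxi S $ s $ s)\<^sup>2 + (Yxi S p $ s $ s)\<^sup>2"
    "0 < (Xeta S $ s $ s)\<^sup>2 + (Yeta S p $ s $ s)\<^sup>2"
    by (auto simp: sum_power2_gt_zero_iff)
qed

lemma admissible_pos:
  assumes "admissible S p"
  shows "0 < Jm S p $ s $ s" "0 < W1 S p $ s $ s" "0 < W2 S p $ s $ s"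
  using assms admissible_metric_pos[OF assms, of s]
  by (auto simp add: admissible_def W_nth simp del: split_paired_All)

lemma admissible_invertible:
  assumes "admissible S p"
  shows "invertible (Jm S p)" "invertible (W1 S p)" "invertible (W2 S p)"
  using admissible_pos[OF assms]
  by (auto intro!: is_diag_invertible is_diag_lower simp: less_imp_neq[symmetric])

lemma is_diag_coefficients:
  assumes "admissible S p"
  shows "is_diag (alpha1 S p)" "is_diag (alpha2 S p)" "is_diag (beta S p)"
    "is_diag (matrix_inv (W1 S p))" "is_diag (matrix_inv (W2 S p))"
proof -
  have "is_diag (matrix_inv (Jm S p))"
    using admissible_pos[OF assms]
    by (intro is_diag_matrix_inv is_diag_lower) (simp add: less_imp_neq[symmetric])
  then show "is_diag (alpha1 S p)" "is_diag (alpha2 S p)" "is_diag (beta S p)"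
    unfolding alpha1_def alpha2_def beta_def
    by (intro is_diag_uminus is_diag_mult is_diag_add is_diag_lower; assumption)+
  show "is_diag (matrix_inv (W1 S p))" "is_diag (matrix_inv (W2 S p))"
    using admissible_pos[OF assms]
    by (auto intro!: is_diag_matrix_inv is_diag_lower simp: less_imp_neq[symmetric])
qed

lemma is_diag_norm:
  assumes "valid_disc S"
  shows "is_diag (Hxi S)" "is_diag (Heta S)"
    "0 < Hxi S $ s $ s" "0 < Heta S $ s $ s"
  using assms sbp_Hn[of "opxi S"] sbp_Hn[of "opeta S"]
  by (auto simp: Hxi_def Heta_def valid_disc_def intro!: is_diag_kron)
     (simp_all add: kron_def mat_def)

text \<open>
  The factors \<open>W\<close> in the boundary norm and in the normal derivative cancel: on the side selected by
  the diagonal projection \<open>Q = e\<^sup>T e\<close> only the contravariant flux survives.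
\<close>

lemma boundary_flux:
  fixes H W a b :: "('s::finite, 's) rmat" and e :: "('b::finite, 's) rmat"
  assumes e: "e ** transpose e = mat 1" and h: "h ** e = e ** H"
    and d: "is_diag (transpose e ** e)" "is_diag H" "is_diag W" "is_diag a" "is_diag b"
      "\<And>s. W $ s $ s \<noteq> 0"
  shows "transpose e ** (h ** e ** W ** transpose e)
      ** (e ** matrix_inv W ** (a ** transpose e ** e ** X + b ** transpose e ** e ** Y))
    = H ** (transpose e ** e) ** (a ** X + b ** Y)"
proof -
  define Q where "Q = transpose e ** e"
  have Q: "is_diag Q" "Q ** Q = Q"
    using d(1) e unfolding Q_def by (simp, metis matrix_mul_assoc matrix_mul_lid)
  have q: "Q $ s $ s * Q $ s $ s = Q $ s $ s" for s
    using arg_cong[OF Q(2), of "\<lambda>A. A $ s $ s"] by (simp add: is_diag_mult_nth Q(1))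
  have Wi: "is_diag (matrix_inv W)" "matrix_inv W $ s $ s = inverse (W $ s $ s)" for s
    using is_diag_matrix_inv d(3,6) by blast+
  have "transpose e ** (h ** e ** W ** transpose e)
      ** (e ** matrix_inv W ** (a ** transpose e ** e ** X + b ** transpose e ** e ** Y))
    = Q ** (H ** (W ** (Q ** (matrix_inv W ** (a ** (Q ** X) + b ** (Q ** Y))))))"
    unfolding h Q_def by (simp add: matrix_mul_assoc)
  also have "\<dots> = H ** (Q ** (a ** X + b ** Y))"
  proof -
    have "q * (h * (w * (q * (inverse w * (a * (q * x) + b * (q * y)))))) = h * (q * (a * x
        + b * y))"
      if qq: "q * q = q" and "w \<noteq> 0" for q h w a b x y :: real
    proof -
      have "q * (h * (w * (q * (inverse w * (a * (q * x) + b * (q * y)))))) =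
         (q * q * q) * h * (a * x + b * y) * (w * inverse w)"
        by (simp add: algebra_simps)
      also have "\<dots> = h * (q * (a * x + b * y))"
        using that(2) by (simp add: qq)
      finally show ?thesis .
    qed
    then show ?thesis
      using q d(6) by (simp add: vec_eq_iff is_diag_mult_nth Q(1) d Wi)
  qed
  finally show ?thesis by (simp add: Q_def matrix_mul_assoc)
qed

text \<open>
  Green's identity in curvilinear coordinates. The Jacobian in the norm matrix cancels the factor
  \<open>J\<^sup>-\<^sup>1\<close> of the operator, so that only the norm matrices of the reference square remain. The second
  derivatives give symmetric matrices grid line by grid line. The two mixed derivatives are not
  symmetric separately: summation by parts turns one into \<open>- Z\<close> and the other into \<open>- Z\<^sup>T\<close> up to
  boundary terms. On each side, the boundary terms of a second and of a mixed derivative together form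
  the flux of \<open>boundary_flux\<close>.
\<close>

lemma lower_block_sbp:
  fixes S :: "('m::{finite, linorder}, 'n::{finite, linorder}, 'k::{finite, linorder}) disc"
  assumes S: "valid_disc S" and p: "admissible S p"
  obtains M where "transpose M = M"
    "Hm S p ** DLm S p = - M + transpose e_w ** Hwm S p ** dwm S p
        + transpose e_e ** Hem S p ** dem S p
       + transpose e_s ** Hsm S p ** dsm S p + transpose e_n ** Hnm S p ** dnm S p"
proof
  let ?al = "alpha1 S p" and ?a2 = "alpha2 S p" and ?b = "beta S p"
  let ?Qw = "transpose e_w ** e_w :: ('m \<times> 'k, 'm \<times> 'k) rmat"
  let ?Qe = "transpose e_e ** e_e :: ('m \<times> 'k, 'm \<times> 'k) rmat"
  let ?Qs = "transpose e_s ** e_s :: ('m \<times> 'k, 'm \<times> 'k) rmat"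
  let ?Qn = "transpose e_n ** e_n :: ('m \<times> 'k, 'm \<times> 'k) rmat"
  define Nx :: "('m \<times> 'k, 'm \<times> 'k) rmat" where
    "Nx = (\<chi> r s. if snd r = snd s
      then Hn (opeta S) $ snd r $ snd r * Mc (opxi S) (\<chi> i. diagonal ?al $ (i, snd r)) $ fst r $
          fst s else 0)"
  define Ny :: "('m \<times> 'k, 'm \<times> 'k) rmat" where
    "Ny = (\<chi> r s. if fst r = fst s
      then Hn (opxi S) $ fst r $ fst r * Mc (opeta S) (\<chi> j. diagonal ?a2 $ (fst r, j)) $ snd r $
          snd s else 0)"
  define G where "G = Hxi S ** Heta S ** ?b"
  define Z where "Z = transpose (Deta S) ** G ** Dxi S"
  have x: "is_sbp (opxi S)" and y: "is_sbp (opeta S)"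
    using S by (simp_all add: valid_disc_def)
  note dg = is_diag_coefficients[OF p] is_diag_norm[OF S] is_diag_lower

  \<comment> \<open>The variable-coefficient second derivatives, grid line by grid line.\<close>
  have Q: "?Qw = kron (outer e_l e_l) (mat 1)" "?Qe = kron (outer e_r e_r) (mat 1)"
    "?Qs = kron (mat 1) (outer e_l e_l)" "?Qn = kron (mat 1) (outer e_r e_r)"
    using row_kron_normal[of _ "mat 1"] kron_row_normal[of _ "mat 1"]
    by (simp_all add: e_w_def e_e_def e_s_def e_n_def)
  have o: "is_diag (outer e_l e_l)" "is_diag (outer e_r e_r)"
    by (auto simp: is_diag_def outer_def e_l_nth e_r_nth)
  have Qd: "is_diag ?Qw" "is_diag ?Qe" "is_diag ?Qs" "is_diag ?Qn"
    unfolding Q by (auto intro!: is_diag_kron o)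
  have Qnth: "?Qw $ r $ r = (if fst r = Min UNIV then 1 else 0)" "?Qe $ r $ r = (if fst r
      = Max UNIV then 1 else 0)"
    "?Qs $ r $ r = (if snd r = Min UNIV then 1 else 0)" "?Qn $ r $ r = (if snd r
        = Max UNIV then 1 else 0)" for r
    unfolding Q by (simp_all add: kron_def mat_def outer_def e_l_nth e_r_nth)
  have Hnth: "Hxi S $ r $ r = Hn (opxi S) $ fst r $ fst r" "Heta S $ r $ r
      = Hn (opeta S) $ snd r $ snd r" for r
    by (simp_all add: Hxi_def Heta_def kron_def mat_def)
  have Mc_sym: "Mc (opxi S) c $ i $ k = Mc (opxi S) c $ k $ i" "Mc (opeta S) c' $ j $ l
      = Mc (opeta S) c' $ l $ j"
    for c i k c' j l
    using arg_cong[OF transpose_Mc[OF x, of c], of "\<lambda>A. A $ i $ k"] arg_cong[OF transpose_Mc[OF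
        y, of c'], of "\<lambda>A. A $ j $ l"]
    by (simp_all add: transpose_def)
  have symN: "transpose Nx = Nx" "transpose Ny = Ny"
    unfolding Nx_def Ny_def transpose_def vec_eq_iff by (auto simp: Mc_sym)
  have xx: "Hxi S ** Heta S ** Dxixi S p = - Nx + Heta S ** (?Qe - ?Qw) ** (?al ** Dhxi S)"
  proof -
    have "(Hxi S ** Heta S ** Dxixi S p) $ r $ s = (- Nx
        + Heta S ** (?Qe - ?Qw) ** (?al ** Dhxi S)) $ r $ s" for r s
    proof -
      have "(Hxi S ** Heta S ** Dxixi S p) $ r $ s = Heta S $ r $ r * (if snd r = snd s then
          Hn (opxi S) $ fst r $ fst r * D2c (opxi S) (\<chi> i. diagonal ?al $ (i, snd r)) $ fst r $
              fst s else 0)"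
        by (simp add: is_diag_mult_nth is_diag_mult dg Dxixi_def Hnth)
      also have "\<dots> = (- Nx + Heta S ** (?Qe - ?Qw) ** (?al ** Dhxi S)) $ r $ s"
        unfolding sbp_D2c_nth[OF x]
        by (cases r; cases s) (simp add: is_diag_mult_nth is_diag_mult is_diag_diff dg Qd Qnth
            Hnth Nx_def Dhxi_def kron_def mat_def
            diagonal_def algebra_simps)
      finally show ?thesis .
    qed
    then show ?thesis by (simp add: vec_eq_iff)
  qed
  have yy: "Hxi S ** Heta S ** Detaeta S p = - Ny + Hxi S ** (?Qn - ?Qs) ** (?a2 ** Dheta S)"
  proof -
    have "(Hxi S ** Heta S ** Detaeta S p) $ r $ s = (- Ny
        + Hxi S ** (?Qn - ?Qs) ** (?a2 ** Dheta S)) $ r $ s" for r s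
    proof -
      have "(Hxi S ** Heta S ** Detaeta S p) $ r $ s = Hxi S $ r $ r * (if fst r = fst s then
          Hn (opeta S) $ snd r $ snd r * D2c (opeta S) (\<chi> j. diagonal ?a2 $ (fst r, j)) $ snd r
              $ snd s else 0)"
        by (simp add: is_diag_mult_nth is_diag_mult dg Detaeta_def Hnth)
      also have "\<dots> = (- Ny + Hxi S ** (?Qn - ?Qs) ** (?a2 ** Dheta S)) $ r $ s"
        unfolding sbp_D2c_nth[OF y]
        by (cases r; cases s) (simp add: is_diag_mult_nth is_diag_mult is_diag_diff dg Qd Qnth
            Hnth Ny_def Dheta_def kron_def mat_def
            diagonal_def algebra_simps)
      finally show ?thesis .
    qed
    then show ?thesis by (simp add: vec_eq_iff)
  qed

  \<comment> \<open>The mixed derivatives, where one of the two first derivatives is moved to the other side.\<close>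
  have parts: "Heta S ** Deta S = - (transpose (Deta S) ** Heta S) + (?Qn - ?Qs)"
    "Hxi S ** Dxi S = - (transpose (Dxi S) ** Hxi S) + (?Qe - ?Qw)"
    unfolding Q by (simp_all add: Heta_def Deta_def Hxi_def Dxi_def kron_mult transpose_kron
        sbp_D1[OF x] sbp_D1[OF y] kron_add_left kron_add_right kron_diff_left kron_diff_right
        kron_minus_left kron_minus_right)
  have comm: "Hxi S ** transpose (Deta S) = transpose (Deta S) ** Hxi S"
    "Heta S ** transpose (Dxi S) = transpose (Dxi S) ** Heta S"
    "Hxi S ** Heta S = Heta S ** Hxi S"
    by (simp_all add: Heta_def Deta_def Hxi_def Dxi_def kron_mult transpose_kron)
  have "Hxi S ** Heta S ** (Deta S ** ?b ** Dxi S) = Hxi S ** (Heta S ** Deta S) ** ?b ** Dxi S"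
    by (simp add: matrix_mul_assoc)
  also have "\<dots> = - (Hxi S ** transpose (Deta S) ** Heta S ** ?b ** Dxi S)
      + Hxi S ** (?Qn - ?Qs) ** (?b ** Dxi S)"
    unfolding parts
        by (simp add: matrix_add_ldistrib matrix_add_mult matrix_diff_mult matrix_minus_mult
        matrix_mul_assoc)
  also have "Hxi S ** transpose (Deta S) ** Heta S ** ?b ** Dxi S = Z"
    unfolding comm(1) Z_def G_def by (simp add: matrix_mul_assoc)
  finally have xy: "Hxi S ** Heta S ** (Deta S ** ?b ** Dxi S)
      = - Z + Hxi S ** (?Qn - ?Qs) ** (?b ** Dxi S)" .
  have G: "transpose G = G"
    unfolding G_def by (intro is_diag_transpose is_diag_mult dg)
  have tZ: "transpose Z = transpose (Dxi S) ** G ** Deta S"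
    unfolding Z_def by (simp add: matrix_transpose_mul matrix_mul_assoc G)
  have "Hxi S ** Heta S ** (Dxi S ** ?b ** Deta S) = Heta S ** (Hxi S ** Dxi S) ** ?b ** Deta S"
    unfolding comm(3) by (simp add: matrix_mul_assoc)
  also have "\<dots> = - (Heta S ** transpose (Dxi S) ** Hxi S ** ?b ** Deta S)
      + Heta S ** (?Qe - ?Qw) ** (?b ** Deta S)"
    unfolding parts
        by (simp add: matrix_add_ldistrib matrix_add_mult matrix_diff_mult matrix_minus_mult
        matrix_mul_assoc)
  also have "Heta S ** transpose (Dxi S) ** Hxi S ** ?b ** Deta S = transpose Z"
    unfolding comm(2) tZ G_def comm(3) by (simp add: matrix_mul_assoc)
  finally have yx: "Hxi S ** Heta S ** (Dxi S ** ?b ** Deta S)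
      = - transpose Z + Heta S ** (?Qe - ?Qw) ** (?b ** Deta S)" .

  \<comment> \<open>The boundary terms collected so far are the normal derivatives of the four sides.\<close>
  have W: "\<And>s. W1 S p $ s $ s \<noteq> 0" "\<And>s. W2 S p $ s $ s \<noteq> 0"
    using admissible_pos[OF p] by (simp_all add: less_imp_neq[symmetric])
  have on: "e_w ** transpose e_w = (mat 1 :: ('k, 'k) rmat)" "e_e ** transpose e_e
      = (mat 1 :: ('k, 'k) rmat)"
    "e_s ** transpose e_s = (mat 1 :: ('m, 'm) rmat)" "e_n ** transpose e_n
        = (mat 1 :: ('m, 'm) rmat)"
    unfolding e_w_def e_e_def e_s_def e_n_def e_l_def e_r_def
    by (rule row_kron_orthonormal kron_row_orthonormal)+
  have he: "Hn (opeta S) ** e_w = e_w ** Heta S" "Hn (opeta S) ** e_e = e_e ** Heta S"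
    "Hn (opxi S) ** e_s = e_s ** Hxi S" "Hn (opxi S) ** e_n = e_n ** Hxi S"
    unfolding e_w_def e_e_def e_s_def e_n_def Heta_def Hxi_def
    by (simp_all add: row_kron_kron kron_row_kron)
  have side: "transpose e_w ** Hwm S p ** dwm S p = - (Heta S ** ?Qw ** (?al ** Dhxi S
      + ?b ** Deta S))"
    "transpose e_e ** Hem S p ** dem S p = Heta S ** ?Qe ** (?al ** Dhxi S + ?b ** Deta S)"
    "transpose e_s ** Hsm S p ** dsm S p = - (Hxi S ** ?Qs ** (?a2 ** Dheta S + ?b ** Dxi S))"
    "transpose e_n ** Hnm S p ** dnm S p = Hxi S ** ?Qn ** (?a2 ** Dheta S + ?b ** Dxi S)"
    unfolding Hwm_def Hem_def Hsm_def Hnm_def dwm_def dem_def dsm_def dnm_def matrix_minus_mult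
      boundary_flux[OF on(1) he(1) Qd(1) dg(7,16,1,3) W(2)]
      boundary_flux[OF on(2) he(2) Qd(2) dg(7,16,1,3) W(2)]
      boundary_flux[OF on(3) he(3) Qd(3) dg(6,15,2,3) W(1)]
      boundary_flux[OF on(4) he(4) Qd(4) dg(6,15,2,3) W(1)]
    by (rule refl)+
  show "transpose (Nx + Ny + Z + transpose Z) = Nx + Ny + Z + transpose Z"
    by (simp add: transpose_add symN)
  have "Hm S p ** DLm S p = Hxi S ** Heta S ** (Jm S p ** matrix_inv (Jm S p)) **
      (Dxixi S p + Deta S ** ?b ** Dxi S + Dxi S ** ?b ** Deta S + Detaeta S p)"
    by (simp add: Hm_def DLm_def matrix_mul_assoc)
  also have "\<dots> = Hxi S ** Heta S ** Dxixi S p + Hxi S ** Heta S ** (Deta S ** ?b ** Dxi S)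
      + Hxi S ** Heta S ** (Dxi S ** ?b ** Deta S) + Hxi S ** Heta S ** Detaeta S p"
    by (simp add: matrix_inv_mult admissible_invertible[OF p] matrix_add_ldistrib)
  finally show "Hm S p ** DLm S p = - (Nx + Ny + Z + transpose Z)
      + transpose e_w ** Hwm S p ** dwm S p
       + transpose e_e ** Hem S p ** dem S p
       + transpose e_s ** Hsm S p ** dsm S p + transpose e_n ** Hnm S p ** dnm S p"
    unfolding xx xy yx yy side
    by (simp add: matrix_add_ldistrib matrix_diff_mult algebra_simps)
qed

section \<open>Self-adjointness of the projected operators\<close>

lemma matrix_mult_scaleR: "A ** (k *\<^sub>R B) = k *\<^sub>R (A ** B)"
  for A :: "('r::finite, 'k::finite) rmat" and B :: "('k, 'c::finite) rmat"
  by (simp add: vec_eq_iff matrix_matrix_mult_def sum_distrib_left mult.left_commute)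

lemma transpose_matrix_inv:
  fixes K :: "('n::finite, 'n) rmat"
  assumes "transpose K = K" "invertible K"
  shows "transpose (matrix_inv K) = matrix_inv K"
proof -
  have "transpose (matrix_inv K ** K) = mat 1"
    by (simp add: matrix_inv_mult assms(2))
  then have "K ** transpose (matrix_inv K) = mat 1"
    by (simp add: matrix_transpose_mul assms(1))
  then show ?thesis by (metis matrix_inv_eqI)
qed

text \<open>
  \<open>L H\<^sup>-\<^sup>1 L\<^sup>T\<close> is positive definite: its quadratic form is the squared \<open>H\<^sup>-\<^sup>1\<close>-norm of \<open>L\<^sup>T x\<close>, and
  \<open>L\<^sup>T\<close> is injective because \<open>L\<close> has a right inverse.
\<close>

lemma invertible_schur_complement:
  fixes H :: "('n::finite, 'n) rmat" and L :: "('l::finite, 'n) rmat"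
  assumes H: "is_diag H" "\<And>s. 0 < H $ s $ s" and R: "L ** R = mat 1"
  shows "invertible (L ** matrix_inv H ** transpose L)"
proof -
  have nz: "H $ s $ s \<noteq> 0" for s
    using H(2)[of s] by simp
  note Hi = is_diag_matrix_inv[OF H(1) nz]
  have "x = 0" if "(L ** matrix_inv H ** transpose L) *v x = 0" for x
  proof -
    define y where "y = transpose L *v x"
    have "x \<bullet> (L *v (matrix_inv H *v y)) = 0"
      using that by (simp add: y_def matrix_vector_mul_assoc matrix_mul_assoc del:
          transpose_matrix_vector)
    then have "y \<bullet> (matrix_inv H *v y) = 0"
      by (simp add: y_def dot_lmul_matrix)
    moreover have "y \<bullet> (matrix_inv H *v y) = (\<Sum>s\<in>UNIV. inverse (H $ s $ s) * (y $ s)\<^sup>2)"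
      by (subst is_diag_eq[OF Hi(1)])
        (simp add: inner_vec_def matrix_vector_mult_def diag_def diagonal_def Hi(2)
            mult_delta_left mult_delta_right
          power2_eq_square mult.commute mult.left_commute cong: if_cong)
    ultimately have "\<forall>s\<in>UNIV. inverse (H $ s $ s) * (y $ s)\<^sup>2 = 0"
      using H(2) by (subst sum_nonneg_eq_0_iff[symmetric]) (auto simp: less_imp_le)
    then have "y = 0"
      using nz by (simp add: vec_eq_iff)
    have "x = transpose (L ** R) *v x"
      by (simp add: R)
    also have "\<dots> = transpose R *v y"
      by (simp add: y_def matrix_transpose_mul matrix_vector_mul_assoc del: transpose_matrix_vector)
    finally show ?thesis using \<open>y = 0\<close> by simp
  qed
  then show ?thesis
    by (simp add: invertible_left_inverse matrix_left_invertible_ker)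
qed

text \<open>
  \<open>P\<close> is the \<open>H\<close>-orthogonal projection onto the kernel of the constraints \<open>L\<close>. The second conclusion
  holds because \<open>H P = H - L\<^sup>T (L H\<^sup>-\<^sup>1 L\<^sup>T)\<^sup>-\<^sup>1 L\<close> is visibly symmetric.
\<close>

lemma constraint_projection:
  fixes H :: "('n::finite, 'n) rmat" and L :: "('l::finite, 'n) rmat"
  assumes H: "is_diag H" "\<And>s. 0 < H $ s $ s" and R: "L ** R = mat 1"
    and P: "P = mat 1 - matrix_inv H ** transpose L ** matrix_inv (L ** matrix_inv H **
        transpose L) ** L"
  shows "L ** P = 0" "H ** P = transpose P ** H"
proof -
  let ?K = "L ** matrix_inv H ** transpose L"
  have nz: "H $ s $ s \<noteq> 0" for s
    using H(2)[of s] by simp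
  have K: "invertible ?K"
    by (rule invertible_schur_complement[OF H R])
  have "transpose ?K = ?K"
    using transpose_congruence[OF is_diag_transpose[OF is_diag_matrix_inv(1)[OF H(1) nz]], of
        "transpose L"]
    by simp
  then have Ki: "transpose (matrix_inv ?K) = matrix_inv ?K"
    by (rule transpose_matrix_inv[OF _ K])
  have "L ** P = L - (?K ** matrix_inv ?K) ** L"
    unfolding P by (simp add: matrix_diff_mult matrix_mul_assoc)
  then show "L ** P = 0"
    by (simp add: matrix_inv_mult[OF K])
  have "H ** P = H - (H ** matrix_inv H) ** transpose L ** matrix_inv ?K ** L"
    unfolding P by (simp add: matrix_diff_mult matrix_mul_assoc)
  then have HP: "H ** P = H - transpose L ** matrix_inv ?K ** L"
    by (simp add: matrix_inv_mult is_diag_invertible H(1) nz)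
  have "transpose (H ** P) = H ** P"
    unfolding HP transpose_diff transpose_congruence[OF Ki] by (simp add: is_diag_transpose H(1))
  then show "H ** P = transpose P ** H"
    by (simp add: matrix_transpose_mul is_diag_transpose H(1))
qed

lemma is_diag_block: "is_diag A \<Longrightarrow> is_diag D \<Longrightarrow> is_diag (block A 0 0 D)"
  by (auto simp: is_diag_def block_def split: sum.split)

lemma Hbar_diag:
  assumes S: "valid_disc S" and p: "admissible S p"
  shows "is_diag (Hbar S p)" "0 < Hbar S p $ s $ s"
proof -
  have x: "is_sbp (opx S)" and y: "is_sbp (opy S)"
    using S by (simp_all add: valid_disc_def)
  have Hp: "is_diag (Hp S)" "0 < Hp S $ r $ r" for r
    using sbp_Hn[OF x] sbp_Hn[OF y] unfolding Hp_def kron_mult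
    by (auto intro!: is_diag_kron) (simp add: kron_def)
  have Hm: "is_diag (Hm S p)" "0 < Hm S p $ r $ r" for r
    using is_diag_norm[OF S] admissible_pos(1)[OF p] is_diag_lower(5)[of S p] unfolding Hm_def
    by (simp_all add: is_diag_mult_nth is_diag_mult del: split_paired_All)
  show "is_diag (Hbar S p)"
    unfolding Hbar_def by (intro is_diag_block Hp Hm)
  show "0 < Hbar S p $ s $ s"
    using Hp(2) Hm(2) by (cases s) (simp_all add: Hbar_def block_def)
qed

lemma e_n_orthonormal: "e_n ** transpose e_n = mat 1"
  unfolding e_n_def e_r_def by (rule kron_row_orthonormal)

lemma Lc_right_inverse:
  obtains R where "(Lc :: ('m + 'm, ('m::{finite,linorder} \<times> 'n::{finite,linorder})
    + ('m \<times> 'k::{finite,linorder})) rmat) ** R = mat 1"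
proof
  \<comment> \<open>Given both constraint values, prescribe them on the northern grid lines of the two blocks; the
    southern values that this induces in the upper block are compensated in the lower one.\<close>
  show "(Lc :: ('m + 'm, ('m \<times> 'n) + ('m \<times> 'k)) rmat)
    ** block (transpose e_n) 0 (transpose e_n ** (e_s :: ('m, 'm \<times> 'n) rmat) ** transpose e_n)
        (- transpose e_n) = mat 1"
    unfolding Lc_def block_mult block_mat[symmetric]
    by (simp add: matrix_minus_mult matrix_mul_assoc e_n_orthonormal)
qed

text \<open>
  After the penalty terms are added, the boundary terms left over are those of the northern sides of
  both blocks and the coupling term at the interface. They form \<open>L\<^sup>T Z\<close>: the northern side of the
  upper block is governed by the first constraint, and the northern side of the lower block combines
  with the coupling term to the second one if the interface norms agree. The projection on the left
  then removes them, because \<open>P\<^sup>T L\<^sup>T = (L P)\<^sup>T = 0\<close>.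
\<close>

lemma symmetric_Dop:
  fixes S :: "('m::{finite, linorder}, 'n::{finite, linorder}, 'k::{finite, linorder}) disc"
  assumes S: "valid_disc S" and p: "admissible S p" and conf: "Hsp S = Hnm S p"
  shows "transpose (Hbar S p ** Dop S p) = Hbar S p ** Dop S p"
proof -
  let ?P = "Pr S p" and ?H = "Hbar S p"
  let ?A = "block (DLp S) 0 0 (DLm S p) + SAT_BC1 S p + SAT_IC S p"
  obtain R where R: "(Lc :: ('m + 'm, ('m \<times> 'n) + ('m \<times> 'k)) rmat) ** R = mat 1"
    by (rule Lc_right_inverse)
  note P = constraint_projection[OF Hbar_diag[OF S p] R Pr_def[of S p]]
  obtain Mp where Mp: "transpose Mp = Mp"
    "Hp S ** DLp S = - Mp + transpose e_w ** Hwp S ** dwp S + transpose e_e ** Hep S ** dep S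
       + transpose e_s ** Hsp S ** dsp S + transpose e_n ** Hnp S ** dnp S"
    by (rule upper_block_sbp[OF S])
  obtain Mm where Mm: "transpose Mm = Mm"
    "Hm S p ** DLm S p = - Mm + transpose e_w ** Hwm S p ** dwm S p
        + transpose e_e ** Hem S p ** dem S p
       + transpose e_s ** Hsm S p ** dsm S p + transpose e_n ** Hnm S p ** dnm S p"
    by (rule lower_block_sbp[OF S p])
  define M where "M = block Mp 0 0 Mm"
  \<comment> \<open>The two diagonal entries multiply the northern and the interface constraint, respectively.\<close>
  define Z where "Z = block (Hnp S ** dnp S) 0 0 (- (Hsp S ** dnm S p))"
  have HHi: "?H ** (matrix_inv ?H ** X) = X" for X :: "('m, 'n, 'k) gmat"
    using Hbar_diag[OF S p]
    by (simp add: matrix_mul_assoc matrix_inv_mult is_diag_invertible less_imp_neq[symmetric])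
  have HA: "?H ** ?A = - M + transpose Lc ** Z"
    unfolding matrix_add_ldistrib SAT_BC1_def SAT_IC_def matrix_minus_mult HHi
    by (simp add: Hbar_def block_mult block_add block_minus Mp(2) Mm(2) M_def Z_def Lc_def
        transpose_block transpose_zero transpose_minus matrix_minus_mult matrix_mul_assoc
            conf[symmetric])
  have tM: "transpose M = M"
    by (simp add: M_def transpose_block transpose_zero Mp(1) Mm(1))
  have LP: "transpose ?P ** transpose Lc = 0"
    using arg_cong[OF P(1), of transpose] by (simp add: matrix_transpose_mul transpose_zero)
  have "?H ** (?P ** ?A ** ?P) = transpose ?P ** (?H ** ?A) ** ?P"
    using P(2) by (simp add: matrix_mul_assoc)
  also have "\<dots> = - (transpose ?P ** M ** ?P) + (transpose ?P ** transpose Lc) ** (Z ** ?P)"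
    unfolding HA
    by (simp add: matrix_add_ldistrib matrix_add_mult matrix_minus_mult matrix_diff_mult
        matrix_mul_assoc)
  finally have "?H ** (?P ** ?A ** ?P) = - (transpose ?P ** M ** ?P)"
    by (simp add: LP)
  then have "?H ** Dop S p = - (wave_speed S)\<^sup>2 *\<^sub>R (transpose ?P ** M ** ?P)"
    by (simp add: Dop_def matrix_mult_scaleR)
  then show ?thesis
    by (simp add: transpose_scalar transpose_minus transpose_congruence[OF tM])
qed

lemma symmetric_Eop:
  fixes S :: "('m::{finite, linorder}, 'n::{finite, linorder}, 'k::{finite, linorder}) disc"
  assumes S: "valid_disc S" and p: "admissible S p"
  shows "transpose (Hbar S p ** Eop S p) = Hbar S p ** Eop S p"
proof -
  let ?P = "Pr S p" and ?H = "Hbar S p"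
  obtain R where R: "(Lc :: ('m + 'm, ('m \<times> 'n) + ('m \<times> 'k)) rmat) ** R = mat 1"
    by (rule Lc_right_inverse)
  note P = constraint_projection[OF Hbar_diag[OF S p] R Pr_def[of S p]]
  have y: "is_sbp (opy S)"
    using S by (simp_all add: valid_disc_def)
  define M :: "('m, 'n, 'k) gmat" where "M
      = block (transpose e_w ** Hwp S ** e_w) 0 0 (transpose e_w ** Hwm S p ** e_w)
      + block (transpose e_e ** Hep S ** e_e) 0 0 (transpose e_e ** Hem S p ** e_e)"
  have he: "Hn (opeta S) ** e_w = e_w ** Heta S" "Hn (opeta S) ** e_e = e_e ** Heta S"
    unfolding e_w_def e_e_def Heta_def by (simp_all add: row_kron_kron)
  have "is_diag (Heta S ** W2 S p)"
    by (intro is_diag_mult is_diag_norm[OF S] is_diag_lower)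
  from transpose_congruence[OF is_diag_transpose[OF this]]
  have "transpose (e ** (Heta S ** W2 S p) ** transpose e) = e ** (Heta S ** W2 S p) ** transpose e"
    for e :: "('k, 'm \<times> 'k) rmat"
    by (metis transpose_transpose)
  then have "transpose (Hwm S p) = Hwm S p" "transpose (Hem S p) = Hem S p"
    unfolding Hwm_def Hem_def he by (simp_all add: matrix_mul_assoc)
  moreover have "transpose (Hwp S) = Hwp S" "transpose (Hep S) = Hep S"
    by (simp_all add: Hwp_def Hep_def is_diag_transpose sbp_Hn y)
  ultimately have tM: "transpose M = M"
    unfolding M_def transpose_add transpose_block by (simp add: transpose_congruence transpose_zero)
  have HHi: "?H ** (matrix_inv ?H ** X) = X" for X :: "('m, 'n, 'k) gmat"
    using Hbar_diag[OF S p]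
    by (simp add: matrix_mul_assoc matrix_inv_mult is_diag_invertible less_imp_neq[symmetric])
  have "?H ** (?P ** SAT_BC2 S p ** ?P) = transpose ?P ** (?H ** SAT_BC2 S p) ** ?P"
    using P(2) by (simp add: matrix_mul_assoc)
  also have "?H ** SAT_BC2 S p = - M"
    unfolding SAT_BC2_def matrix_minus_mult HHi M_def ..
  finally have "?H ** Eop S p = - wave_speed S *\<^sub>R (transpose ?P ** M ** ?P)"
    by (simp add: Eop_def matrix_mult_scaleR matrix_minus_mult)
  then show ?thesis
    by (simp add: transpose_scalar transpose_minus transpose_congruence[OF tM])
qed

section \<open>Dependence on the shape parameter\<close>

lemmas matrix_differentiable =
  differentiable_add differentiable_diff differentiable_minus differentiable_scaleR
  differentiable_matrix_mult differentiable_const differentiable_block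

lemma differentiable_metric:
  fixes S :: "('m::{finite, linorder}, 'n::{finite, linorder}, 'k::{finite, linorder}) disc"
  shows "Yxi S differentiable (at p)" "Yeta S differentiable (at p)" "Jm S differentiable (at p)"
proof -
  have y: "(\<lambda>q. (A *v ym S q) $ s) differentiable (at p)" for A :: "('m \<times> 'k, 'm \<times> 'k) rmat" and s
    unfolding matrix_vector_mult_def ym_def
    by (auto intro!: differentiable_sum differentiable_mult differentiable_add differentiable_diff
        differentiable_const differentiable_vec_nth differentiable_ident)
  show Y: "Yxi S differentiable (at p)" "Yeta S differentiable (at p)"
    unfolding Yxi_def[abs_def] Yeta_def[abs_def] by (intro differentiable_diag y)+
  then show "Jm S differentiable (at p)"
    unfolding Jm_def[abs_def] by (intro matrix_differentiable)
qed

lemma eventually_admissible: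
  assumes "admissible S p"
  shows "\<forall>\<^sub>F q in nhds p. admissible S q"
proof -
  have "\<forall>\<^sub>F q in nhds p. 0 < Jm S q $ s $ s" for s
  proof -
    have "(\<lambda>q. Jm S q $ s $ s) differentiable (at p)"
      using differentiable_metric(3) by (rule differentiable_matrix_nth)
    then have "isCont (\<lambda>q. Jm S q $ s $ s) p"
      by (rule differentiable_imp_continuous_within)
    moreover have "0 < Jm S p $ s $ s"
      using assms by (rule admissible_pos)
    ultimately show ?thesis
      unfolding eventually_nhds_conv_at isCont_def by (blast dest: order_tendstoD(1))
  qed
  then show ?thesis
    unfolding admissible_def by (rule eventually_all_finite)
qed

lemma differentiable_lower:
  assumes S: "valid_disc S" and p: "admissible S p"
  shows "DLm S differentiable (at p)" "dwm S differentiable (at p)" "dem S differentiable (at p)"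
    "dsm S differentiable (at p)" "dnm S differentiable (at p)" "Hm S differentiable (at p)"
    "Hwm S differentiable (at p)" "Hem S differentiable (at p)" "Hsm S differentiable (at p)"
proof -
  have x: "is_sbp (opxi S)" and y: "is_sbp (opeta S)"
    using S by (simp_all add: valid_disc_def)
  note Y = differentiable_metric[of S p]
  note inv = admissible_invertible[OF p]
  have Ji: "(\<lambda>q. matrix_inv (Jm S q)) differentiable (at p)"
    by (rule differentiable_matrix_inv[OF Y(3) inv(1)])
  have coeff: "alpha1 S differentiable (at p)" "alpha2 S differentiable (at p)"
      "beta S differentiable (at p)"
    unfolding alpha1_def[abs_def] alpha2_def[abs_def] beta_def[abs_def]
    by (intro matrix_differentiable Y Ji)+
  have "(\<lambda>q. W1 S q) differentiable (at p)"
    unfolding W1_def diagonal_def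
    using admissible_metric_pos[OF p]
    by (intro differentiable_diag)
      (simp add: is_diag_mult_nth is_diag_lower flip: power2_eq_square,
        intro differentiable_sqrt differentiable_add differentiable_power differentiable_const
          differentiable_matrix_nth Y, simp)
  moreover have "(\<lambda>q. W2 S q) differentiable (at p)"
    unfolding W2_def diagonal_def
    using admissible_metric_pos[OF p]
    by (intro differentiable_diag)
      (simp add: is_diag_mult_nth is_diag_lower flip: power2_eq_square,
        intro differentiable_sqrt differentiable_add differentiable_power differentiable_const
          differentiable_matrix_nth Y, simp)
  ultimately have W: "W1 S differentiable (at p)" "W2 S differentiable (at p)"
    by simp_all
  note Wi = differentiable_matrix_inv[OF W(1) inv(2)] differentiable_matrix_inv[OF W(2) inv(3)]
  have line: "(\<lambda>q. D2c A (\<chi> i. diagonal (a q) $ f i)) differentiable (at p)"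
    if "is_sbp A" "a differentiable (at p)" for A a and f :: "_ \<Rightarrow> _"
    using that by (intro differentiable_D2c) (simp_all add: differentiable_vec_iff diagonal_def)
  have "(\<lambda>q. Dxixi S q) differentiable (at p)"
    unfolding differentiable_matrix_iff
  proof (intro allI)
    fix r s
    show "(\<lambda>q. Dxixi S q $ r $ s) differentiable (at p)"
      using differentiable_matrix_nth[OF line[OF x coeff(1)]]
      by (cases "snd r = snd s") (simp_all add: Dxixi_def)
  qed
  moreover have "(\<lambda>q. Detaeta S q) differentiable (at p)"
    unfolding differentiable_matrix_iff
  proof (intro allI)
    fix r s
    show "(\<lambda>q. Detaeta S q $ r $ s) differentiable (at p)"
      using differentiable_matrix_nth[OF line[OF y coeff(2)]]
      by (cases "fst r = fst s") (simp_all add: Detaeta_def)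
  qed
  ultimately show "DLm S differentiable (at p)"
    unfolding DLm_def[abs_def] by (intro matrix_differentiable coeff Ji) simp_all
  show "dwm S differentiable (at p)" "dem S differentiable (at p)"
    "dsm S differentiable (at p)" "dnm S differentiable (at p)"
    unfolding dwm_def[abs_def] dem_def[abs_def] dsm_def[abs_def] dnm_def[abs_def]
    by (intro matrix_differentiable coeff Wi)+
  show "Hm S differentiable (at p)"
    unfolding Hm_def[abs_def] by (intro matrix_differentiable Y)
  show "Hwm S differentiable (at p)" "Hem S differentiable (at p)" "Hsm S differentiable (at p)"
    unfolding Hwm_def[abs_def] Hem_def[abs_def] Hsm_def[abs_def]
    by (intro matrix_differentiable W)+
qed

lemma differentiable_Dop_Eop:
  fixes S :: "('m::{finite, linorder}, 'n::{finite, linorder}, 'k::{finite, linorder}) disc"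
  assumes S: "valid_disc S" and p: "admissible S p"
  shows "Dop S differentiable (at p)" "Eop S differentiable (at p)"
proof -
  note lower = differentiable_lower[OF S p]
  have H: "Hbar S differentiable (at p)"
    unfolding Hbar_def[abs_def] by (intro matrix_differentiable lower)
  have Hi: "(\<lambda>q. matrix_inv (Hbar S q)) differentiable (at p)"
    using Hbar_diag[OF S p]
    by (intro differentiable_matrix_inv[OF H] is_diag_invertible) (simp_all add:
        less_imp_neq[symmetric])
  obtain R where R: "(Lc :: ('m + 'm, ('m \<times> 'n) + ('m \<times> 'k)) rmat) ** R = mat 1"
    by (rule Lc_right_inverse)
  have P: "Pr S differentiable (at p)"
    unfolding Pr_def[abs_def]
    by (intro matrix_differentiable differentiable_matrix_inv Hi
        invertible_schur_complement[OF Hbar_diag[OF S p] R])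
  have SAT: "SAT_BC1 S differentiable (at p)" "SAT_BC2 S differentiable (at p)"
      "SAT_IC S differentiable (at p)"
    unfolding SAT_BC1_def[abs_def] SAT_BC2_def[abs_def] SAT_IC_def[abs_def]
    by (intro matrix_differentiable Hi lower)+
  show "Dop S differentiable (at p)" "Eop S differentiable (at p)"
    unfolding Dop_def[abs_def] Eop_def[abs_def]
    by (intro matrix_differentiable P lower SAT)+
qed

section \<open>Evolution equations\<close>

lemma bounded_bilinear_matrix_vector:
  "bounded_bilinear ((*v) :: ('r::finite, 'c::finite) rmat \<Rightarrow> real^'c \<Rightarrow> real^'r)"
  unfolding bilinear_conv_bounded_bilinear[symmetric] bilinear_def linear_iff
  by (auto simp: matrix_vector_mult_add_rdistrib matrix_vector_right_distrib
      scaleR_matrix_vector_assoc matrix_scaleR_vector_ac)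

lemma bounded_bilinear_wprod: "bounded_bilinear (wprod H)"
  unfolding bilinear_conv_bounded_bilinear[symmetric] bilinear_def linear_iff wprod_def
  by (auto simp: inner_add_left inner_add_right matrix_vector_right_distrib
      matrix_vector_mult_scaleR)

lemma wprod_self_adjoint:
  assumes "transpose H = H" "transpose (H ** A) = H ** A"
  shows "wprod H (A *v u) v = wprod H u (A *v v)"
proof -
  have "wprod H (A *v u) v = (transpose H *v (A *v u)) \<bullet> v"
    unfolding wprod_def by (simp flip: dot_lmul_matrix)
  also have "\<dots> = (transpose (H ** A) *v u) \<bullet> v"
    by (simp add: assms matrix_vector_mul_assoc del: transpose_matrix_vector)
  also have "\<dots> = wprod H u (A *v v)"
    by (simp add: wprod_def dot_lmul_matrix matrix_vector_mul_assoc)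
  finally show ?thesis .
qed

text \<open>
  The notion of a classical solution with the velocity \<open>v\<close> as an explicit argument, so that the
  velocity can be estimated and differentiated by name.
\<close>

definition solution_pair ::
  "real \<Rightarrow> real set \<Rightarrow> ('n::finite, 'n) rmat \<Rightarrow> ('n, 'n) rmat \<Rightarrow> (real \<Rightarrow> 'n rvec) \<Rightarrow>
   (real \<Rightarrow> 'n rvec) \<Rightarrow> (real \<Rightarrow> 'n rvec) \<Rightarrow> bool"
  where "solution_pair T I A B g u v \<longleftrightarrow>
     (\<forall>t\<in>{0..T}. (u has_vector_derivative v t) (at t within {0..T})) \<and>
     continuous_on {0..T} v \<and>
     (\<forall>t\<in>I. (v has_vector_derivative A *v u t + B *v v t + g t) (at t within {0..T})) \<and>
     u 0 = 0 \<and> v 0 = 0"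

text \<open>
  The velocity that is existentially quantified in the notion of a solution is unique, because
  one-sided derivatives on a nondegenerate closed interval are. It can thus be named as a derivative.
\<close>

lemma solves_ivp_velocity:
  assumes "solves_ivp T I A B g u" "0 < T" "I \<subseteq> {0..T}"
  shows "solution_pair T I A B g u (\<lambda>t. vector_derivative u (at t within {0..T}))"
proof -
  let ?v = "\<lambda>t. vector_derivative u (at t within {0..T})"
  obtain v where v: "solution_pair T I A B g u v"
    using assms(1) unfolding solves_ivp_def solution_pair_def by blast
  have eq: "?v t = v t" if "t \<in> {0..T}" for t
    using v that assms(2) vector_derivative_within_closed_interval unfolding solution_pair_def
        by blast
  have "continuous_on {0..T} ?v"
    using v unfolding solution_pair_def by (subst continuous_on_cong[OF refl eq]) auto
  moreover have "(?v has_vector_derivative A *v u t + B *v ?v t + g t) (at t within {0..T})"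
      if "t \<in> I" for t
  proof -
    have t: "t \<in> {0..T}" using that assms(3) by blast
    show ?thesis
      unfolding eq[OF t] using v that
      by (intro has_vector_derivative_transform[OF t eq]) (auto simp: solution_pair_def)
  qed
  ultimately show ?thesis
    using v eq assms(2) unfolding solution_pair_def by (auto simp: eq)
qed

lemma solution_pair_continuous:
  assumes "solution_pair T I A B g u v"
  shows "continuous_on {0..T} u" "continuous_on {0..T} v"
  using assms continuous_on_vector_derivative[of "{0..T}" u v] unfolding solution_pair_def by auto

lemma solution_pair_interior:
  assumes "solution_pair T I A B g u v" "0 < t" "t < T" "{0<..<T} \<subseteq> I"
  shows "(u has_vector_derivative v t) (at t)"
    "(v has_vector_derivative A *v u t + B *v v t + g t) (at t)"
proof -
  have "t \<in> {0..T}" "t \<in> I" using assms by auto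
  then show "(u has_vector_derivative v t) (at t)"
    "(v has_vector_derivative A *v u t + B *v v t + g t) (at t)"
    using assms(1) at_within_Icc_at[OF assms(2,3)] unfolding solution_pair_def by fastforce+
qed

text \<open>
  Gronwall's inequality, because \<open>exp (- M t) * y t - c * t\<close> is nonincreasing.
\<close>

lemma gronwall_bound:
  fixes y :: "real \<Rightarrow> real"
  assumes y: "continuous_on {0..T} y" "y 0 = 0"
    and d: "\<And>t. 0 < t \<Longrightarrow> t < T \<Longrightarrow> (y has_real_derivative y' t) (at t)"
    and le: "\<And>t. 0 < t \<Longrightarrow> t < T \<Longrightarrow> y' t \<le> M * y t + c"
    and M: "0 \<le> M" and c: "0 \<le> c" and t: "t \<in> {0..T}"
  shows "y t \<le> c * (T * exp (M * T))"
proof -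
  define z where "z = (\<lambda>t. exp (- (M * t)) * y t - c * t)"
  have "z t \<le> z 0"
  proof (rule DERIV_nonpos_imp_decreasing_open[where f = z and a = 0 and b = t])
    show "0 \<le> t" using t by simp
    show "continuous_on {0..t} z"
      unfolding z_def using t by (intro continuous_intros continuous_on_subset[OF y(1)]) auto
    fix s assume s: "0 < s" "s < t"
    have "(z has_real_derivative exp (- (M * s)) * (y' s - M * y s) - c) (at s)"
      unfolding z_def using s t by (auto intro!: derivative_eq_intros d simp: algebra_simps)
    moreover have "exp (- (M * s)) * (y' s - M * y s) \<le> exp (- (M * s)) * c"
      using le[of s] s t by (intro mult_left_mono) auto
    moreover have "exp (- (M * s)) * c \<le> 1 * c"
      using M s c by (intro mult_right_mono) auto
    ultimately have "(z has_real_derivative exp (- (M * s)) * (y' s - M * y s) - c) (at s)"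
      "exp (- (M * s)) * (y' s - M * y s) - c \<le> 0"
      by linarith+
    then show "\<exists>l. (z has_real_derivative l) (at s) \<and> l \<le> 0"
      by blast
  qed
  then have "exp (- (M * t)) * y t \<le> c * t"
    using y(2) by (simp add: z_def)
  then have "exp (M * t) * (exp (- (M * t)) * y t) \<le> exp (M * t) * (c * t)"
    by (intro mult_left_mono) auto
  also have "exp (M * t) * (exp (- (M * t)) * y t) = y t"
    by (simp add: exp_minus field_simps)
  also have "exp (M * t) * (c * t) \<le> exp (M * T) * (c * T)"
    using t c M by (intro mult_mono) (auto intro: mult_left_mono)
  finally show ?thesis by (simp add: ac_simps)
qed

text \<open>
  Energy estimate: Gronwall's inequality for \<open>|u|\<^sup>2 + |v|\<^sup>2\<close>. The constant depends on the coefficients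
  only through the bound \<open>K\<close>, hence the estimate is uniform over nearby coefficients, and it is linear
  in the size \<open>e\<close> of the source.
\<close>

lemma solution_pair_bound:
  assumes sol: "solution_pair T {0<..T} A B g u v"
    and A: "\<And>x. norm (A *v x) \<le> K * norm x" and B: "\<And>x. norm (B *v x) \<le> K * norm x"
    and g: "\<And>t. t \<in> {0..T} \<Longrightarrow> norm (g t) \<le> e" and K: "0 \<le> K" and e: "0 \<le> e" and t: "t \<in> {0..T}"
  shows "norm (u t) \<le> e * sqrt (T * exp ((2 + 3 * K) * T))"
    "norm (v t) \<le> e * sqrt (T * exp ((2 + 3 * K) * T))"
proof -
  define y where "y = (\<lambda>t. u t \<bullet> u t + v t \<bullet> v t)"
  define y' where "y' = (\<lambda>t. 2 * (u t \<bullet> v t) + 2 * (v t \<bullet> (A *v u t + B *v v t + g t)))"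
  note cont = solution_pair_continuous[OF sol]
  have "y t \<le> e\<^sup>2 * (T * exp ((2 + 3 * K) * T))"
  proof (rule gronwall_bound[where y = y and y' = y' and M = "2 + 3 * K" and c = "e\<^sup>2"])
    show "continuous_on {0..T} y"
      unfolding y_def by (intro continuous_intros cont)
    show "y 0 = 0"
      using sol by (simp add: y_def solution_pair_def)
    fix s assume s: "0 < s" "s < T"
    have sub: "{0<..<T} \<subseteq> {0<..T}" by auto
    note d = solution_pair_interior[OF sol s sub]
    show "(y has_real_derivative y' s) (at s)"
      unfolding y_def y'_def has_real_derivative_iff_has_vector_derivative
      by (rule has_vector_derivative_eq_rhs[OF has_vector_derivative_add[OF
            bounded_bilinear.has_vector_derivative[OF bounded_bilinear_inner d(1) d(1)]
            bounded_bilinear.has_vector_derivative[OF bounded_bilinear_inner d(2) d(2)]]])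
        (simp add: inner_commute)
    have ip: "v s \<bullet> x \<le> norm (v s) * c" if "norm x \<le> c" for x c
      using norm_cauchy_schwarz[of "v s" x] mult_left_mono[OF that norm_ge_zero[of "v s"]] by simp
    have young: "2 * p1 + 2 * (p2 + p3 + p4) \<le> (2 + 3 * K) * (a\<^sup>2 + b\<^sup>2) + e\<^sup>2"
      if "p1 \<le> a * b" "p2 \<le> b * (K * a)" "p3 \<le> b * (K * b)" "p4 \<le> b * e" for p1 p2 p3 p4 a b :: real
    proof -
      \<comment> \<open>The right-hand side minus the bound for the left-hand side is a sum of
        squares with nonnegative weights.\<close>
      have "(2 + 3 * K) * (a\<^sup>2 + b\<^sup>2) + e\<^sup>2 - (2 * (a * b) + 2 * (b * (K * a) + b * (K * b)
          + b * e))
          = (a - b)\<^sup>2 + (b - e)\<^sup>2 + a\<^sup>2 + K * ((a - b)\<^sup>2 + 2 * a\<^sup>2)"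
        by (simp add: power2_eq_square algebra_simps)
      also have "\<dots> \<ge> 0"
        using K by (intro add_nonneg_nonneg mult_nonneg_nonneg) simp_all
      finally have "2 * (a * b) + 2 * (b * (K * a) + b * (K * b) + b * e) \<le> (2 + 3 * K) * (a\<^sup>2
          + b\<^sup>2) + e\<^sup>2"
        by simp
      moreover have "2 * p1 + 2 * (p2 + p3 + p4) \<le> 2 * (a * b) + 2 * (b * (K * a) + b * (K * b)
          + b * e)"
        using that by (intro add_mono mult_left_mono) auto
      ultimately show ?thesis by (rule order_trans[rotated])
    qed
    have "y' s \<le> (2 + 3 * K) * ((norm (u s))\<^sup>2 + (norm (v s))\<^sup>2) + e\<^sup>2"
      unfolding y'_def inner_add_right using s
      by (intro young norm_cauchy_schwarz ip A B g) auto
    then show "y' s \<le> (2 + 3 * K) * y s + e\<^sup>2"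
      by (simp add: y_def dot_square_norm)
  qed (use K t in auto)
  moreover have "0 \<le> (norm (u t))\<^sup>2" "0 \<le> (norm (v t))\<^sup>2"
    by simp_all
  ultimately have "(norm (u t))\<^sup>2 \<le> e\<^sup>2 * (T * exp ((2 + 3 * K) * T))"
    "(norm (v t))\<^sup>2 \<le> e\<^sup>2 * (T * exp ((2 + 3 * K) * T))"
    unfolding y_def dot_square_norm by linarith+
  from real_sqrt_le_mono[OF this(1)] real_sqrt_le_mono[OF this(2)]
  show "norm (u t) \<le> e * sqrt (T * exp ((2 + 3 * K) * T))"
    "norm (v t) \<le> e * sqrt (T * exp ((2 + 3 * K) * T))"
    using e by (simp_all add: real_sqrt_mult)
qed

text \<open>
  The difference of two solutions can be taken to evolve under either pair of coefficients, at the
  price of a source that involves the other solution. The roles are exchanged by swapping the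
  arguments.
\<close>

lemma solution_pair_diff:
  assumes "solution_pair T I A B f u v" "solution_pair T I A' B' f u' v'"
  shows "solution_pair T I A B (\<lambda>t. (A - A') *v u' t + (B - B') *v v' t)
    (\<lambda>t. u t - u' t) (\<lambda>t. v t - v' t)"
  using assms unfolding solution_pair_def
  by (auto intro!: continuous_on_diff derivative_eq_intros
      simp: matrix_vector_mult_diff_rdistrib matrix_vector_mult_diff_distrib)

text \<open>
  Time reversal changes the sign of the velocity, and with it the sign of the damping term.
\<close>

lemma adjoint_reversed:
  assumes "solution_pair T {0..T} A B (\<lambda>\<tau>. - \<rho> (T - \<tau>) *\<^sub>R d) lam kap"
  defines "\<mu> \<equiv> (\<lambda>t. lam (T - t))" and "\<nu> \<equiv> (\<lambda>t. - kap (T - t))"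
  shows "t \<in> {0..T} \<Longrightarrow> (\<mu> has_vector_derivative \<nu> t) (at t within {0..T})"
    "t \<in> {0..T} \<Longrightarrow> (\<nu> has_vector_derivative A *v \<mu> t - B *v \<nu> t - \<rho> t *\<^sub>R d) (at t within {0..T})"
    "\<mu> T = 0" "\<nu> T = 0"
proof -
  have rev: "((\<lambda>t. h (T - t)) has_vector_derivative - h') (at t within {0..T})"
    if "(h has_vector_derivative h') (at (T - t) within {0..T})" for h h' t
  proof -
    have im: "(\<lambda>t. T - t) ` {0..T} = {0..T}"
      by (auto simp: image_def intro!: bexI[of _ "T - _"])
    have "((\<lambda>t. T - t) has_vector_derivative -1) (at t within {0..T})"
      by (auto intro!: derivative_eq_intros)
    from vector_diff_chain_within[OF this, of h h'] that show ?thesis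
      by (simp add: im o_def)
  qed
  show "(\<mu> has_vector_derivative \<nu> t) (at t within {0..T})" if "t \<in> {0..T}"
    using assms(1) that unfolding \<mu>_def \<nu>_def solution_pair_def by (intro rev) auto
  show "(\<nu> has_vector_derivative A *v \<mu> t - B *v \<nu> t - \<rho> t *\<^sub>R d) (at t within {0..T})"
      if "t \<in> {0..T}"
  proof -
    have "T - t \<in> {0..T}" using that by auto
    then have "(kap has_vector_derivative A *v lam (T - t) + B *v kap (T - t)
        + - \<rho> (T - (T - t)) *\<^sub>R d)
        (at (T - t) within {0..T})"
      using assms(1) unfolding solution_pair_def by blast
    from has_vector_derivative_minus[OF rev[OF this]] show ?thesis
      unfolding \<mu>_def \<nu>_def
      by (simp add: bounded_bilinear.minus_right[OF bounded_bilinear_matrix_vector])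
  qed
  show "\<mu> T = 0" "\<nu> T = 0"
    using assms(1) by (simp_all add: \<mu>_def \<nu>_def solution_pair_def)
qed

text \<open>
  With \<open>\<mu>(t) = \<lambda>(T - t)\<close> and \<open>\<nu> = \<mu>'\<close>, the function
  \<open>(\<nu>, u)\<^sub>H - (\<mu>, v)\<^sub>H + (\<mu>, B u)\<^sub>H\<close> vanishes at both end points, at \<open>0\<close> because \<open>u\<close> and \<open>v\<close> do, and at
  \<open>T\<close> because \<open>\<mu>\<close> and \<open>\<nu>\<close> do. In its derivative, the terms with \<open>A\<close> and \<open>B\<close> cancel by self-adjointness,
  and what is left is minus the integrand below. The third summand accounts for the opposite signs of the
  damping in the two equations.
\<close>

lemma duality:
  fixes A B H :: "('n::finite, 'n) rmat"
  assumes T: "0 \<le> T"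
    and H: "transpose H = H" "transpose (H ** A) = H ** A" "transpose (H ** B) = H ** B"
    and sol: "solution_pair T {0<..T} A B G u v"
    and adj: "solution_pair T {0..T} A B (\<lambda>\<tau>. - \<rho> (T - \<tau>) *\<^sub>R d) lam kap"
  shows "((\<lambda>t. \<rho> t * wprod H d (u t) + wprod H (lam (T - t)) (G t)) has_integral 0) {0..T}"
proof -
  define \<mu> \<nu> where "\<mu> = (\<lambda>t. lam (T - t))" and "\<nu> = (\<lambda>t. - kap (T - t))"
  note rev = adjoint_reversed[OF adj, folded \<mu>_def \<nu>_def]
  have cont: "continuous_on {0..T} \<mu>" "continuous_on {0..T} \<nu>"
    by (rule continuous_on_vector_derivative; rule rev; assumption)+
  interpret W: bounded_bilinear "wprod H" by (rule bounded_bilinear_wprod)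
  define \<Phi> where "\<Phi> = (\<lambda>t. wprod H (\<nu> t) (u t) - wprod H (\<mu> t) (v t) + wprod H (\<mu> t) (B *v u t))"
  have "((\<lambda>t. - (\<rho> t * wprod H d (u t)) - wprod H (\<mu> t) (G t)) has_integral (\<Phi> T - \<Phi> 0)) {0..T}"
  proof (rule fundamental_theorem_of_calculus_interior)
    have Bu: "continuous_on {0..T} (\<lambda>t. B *v u t)"
      by (rule bounded_linear.continuous_on[OF matrix_vector_mul_bounded_linear])
        (rule solution_pair_continuous[OF sol])
    show "continuous_on {0..T} \<Phi>"
      unfolding \<Phi>_def
      by (intro continuous_on_add continuous_on_diff W.continuous_on cont Bu
          solution_pair_continuous[OF sol])
    fix t assume t: "t \<in> {0<..<T}"
    then have at: "at t within {0..T} = at t" "t \<in> {0..T}"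
      by (auto simp: at_within_Icc_at)
    have "0 < t" "t < T" "{0<..<T} \<subseteq> {0<..T}" using t by auto
    note d = solution_pair_interior[OF sol this]
    note dBu = bounded_linear.has_vector_derivative[OF matrix_vector_mul_bounded_linear d(1), of B]
    note r = rev(1,2)[OF at(2), unfolded at(1)]
    have adjAB: "wprod H (A *v x) y = wprod H x (A *v y)" "wprod H (B *v x) y
        = wprod H x (B *v y)" for x y
      using wprod_self_adjoint H by blast+
    show "(\<Phi> has_vector_derivative - (\<rho> t * wprod H d (u t)) - wprod H (\<mu> t) (G t)) (at t)"
      unfolding \<Phi>_def
      by (rule has_vector_derivative_eq_rhs[OF has_vector_derivative_add[OF
          has_vector_derivative_diff[OF
            W.has_vector_derivative[OF r(2) d(1)] W.has_vector_derivative[OF r(1) d(2)]]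
            W.has_vector_derivative[OF r(1) dBu]]])
        (simp add: W.add_left W.add_right W.diff_left W.diff_right W.scaleR_left W.minus_left
            adjAB \<mu>_def \<nu>_def)
  qed (rule T)
  moreover have "\<Phi> T = 0" "\<Phi> 0 = 0"
    using sol rev(3,4)
        by (simp_all add: \<Phi>_def \<mu>_def \<nu>_def solution_pair_def W.zero_left W.zero_right)
  ultimately have "((\<lambda>t. - (\<rho> t * wprod H d (u t)) - wprod H (\<mu> t) (G t)) has_integral 0) {0..T}"
    by simp
  from has_integral_neg[OF this] show ?thesis
    by (simp add: \<mu>_def add.commute)
qed

section \<open>The reduced gradient\<close>

text \<open>
  The bound at \<open>q = p\<close> forces \<open>R p = 0\<close>, so \<open>R\<close> itself is \<open>o(|q - p|)\<close>.
\<close>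

lemma has_derivative_zero_of_quadratic_bound:
  fixes R :: "'a::real_normed_vector \<Rightarrow> 'b::real_normed_vector"
  assumes "\<forall>\<^sub>F q in nhds p. norm (R q) \<le> C * (norm (q - p))\<^sup>2"
  shows "(R has_derivative (\<lambda>h. 0)) (at p)"
  unfolding has_derivative_at_alt
proof (intro conjI allI impI)
  show "bounded_linear (\<lambda>h. 0 :: 'b)" by (rule bounded_linear_zero)
  fix e :: real assume e: "0 < e"
  obtain r where r: "0 < r" "\<And>q. dist q p < r \<Longrightarrow> norm (R q) \<le> C * (norm (q - p))\<^sup>2"
    using assms unfolding eventually_nhds_metric by blast
  have Rp: "R p = 0"
    using r(2)[of p] r(1) by simp
  define d where "d = min r (e / (\<bar>C\<bar> + 1))"
  have "0 < d"
    using r(1) e by (simp add: d_def add_nonneg_pos)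
  moreover have "norm (R q - R p - 0) \<le> e * norm (q - p)" if "norm (q - p) < d" for q
  proof -
    have "norm (R q) \<le> C * (norm (q - p))\<^sup>2"
      using that by (intro r(2)) (simp add: d_def dist_norm)
    also have "\<dots> \<le> (\<bar>C\<bar> + 1) * norm (q - p) * norm (q - p)"
      by (simp add: power2_eq_square mult.assoc mult_right_mono)
    also have "\<dots> \<le> e * norm (q - p)"
    proof (rule mult_right_mono)
      have "norm (q - p) \<le> e / (\<bar>C\<bar> + 1)" using that by (simp add: d_def)
      then show "(\<bar>C\<bar> + 1) * norm (q - p) \<le> e"
        by (simp add: field_simps)
    qed simp
    finally show ?thesis by (simp add: Rp)
  qed
  ultimately show "\<exists>d>0. \<forall>q. norm (q - p) < d \<longrightarrow> norm (R q - R p - 0) \<le> e * norm (q - p)"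
    by blast
qed

lemma has_derivative_lipschitz_at:
  assumes "(f has_derivative f') (at p)"
  obtains C where "0 \<le> C" "\<forall>\<^sub>F q in nhds p. norm (f q - f p) \<le> C * norm (q - p)"
proof
  have f': "bounded_linear f'"
    using assms by (rule has_derivative_bounded_linear)
  show "0 \<le> onorm f' + 1"
    using onorm_pos_le[OF f'] by simp
  obtain d where d: "0 < d" "\<And>q. norm (q - p) < d \<Longrightarrow> norm (f q - f p - f' (q - p))
      \<le> 1 * norm (q - p)"
    using assms zero_less_one unfolding has_derivative_at_alt by blast
  have "norm (f q - f p) \<le> (onorm f' + 1) * norm (q - p)" if "norm (q - p) < d" for q
    using d(2)[OF that] onorm[OF f', of "q - p"] norm_triangle_sub[of "f q - f p" "f' (q - p)"]
    by (simp add: algebra_simps)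
  then show "\<forall>\<^sub>F q in nhds p. norm (f q - f p) \<le> (onorm f' + 1) * norm (q - p)"
    unfolding eventually_nhds_metric dist_norm using d(1) by blast
qed

text \<open>
  The adjoint-state formula for a family of evolution equations whose coefficients depend
  differentiably on a parameter. Self-adjointness is required at the base point only, in an inner
  product that is held fixed there: the perturbation equation is written once with the
  coefficients at \<open>q\<close>, to estimate \<open>w\<^sub>q - w\<^sub>p\<close> by data of order \<open>|q - p|\<close>, and once with those at \<open>p\<close>,
  to apply duality.
\<close>

lemma reduced_gradient:
  fixes A B :: "'q::real_normed_vector \<Rightarrow> ('n::finite, 'n) rmat" and H :: "('n, 'n) rmat"
  assumes T: "0 < T"
    and A: "(A has_derivative A') (at p)" and B: "(B has_derivative B') (at p)"
    and H: "transpose H = H" "transpose (H ** A p) = H ** A p" "transpose (H ** B p) = H ** B p"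
    and vd: "continuous_on {0..T} vd"
    and forward: "\<forall>\<^sub>F q in nhds p. solves_ivp T {0<..T} (A q) (B q) g (w q)"
    and adjoint: "solves_ivp T {0..T} (A p) (B p)
      (\<lambda>\<tau>. - (wprod H d (w p (T - \<tau>)) - vd (T - \<tau>)) *\<^sub>R d) lam"
  shows "((\<lambda>q. 1 / 2 * integral {0..T} (\<lambda>t. (wprod H d (w q t) - vd t)\<^sup>2)) has_derivative
    (\<lambda>h. integral {0..T} (\<lambda>t. - wprod H (lam (T - t)) (A' h *v w p t)
        + wprod H (vector_derivative (\<lambda>s. lam (T - s)) (at t within {0..T})) (B' h *v w p t))))
            (at p)"
proof -
  define \<rho> where "\<rho> = (\<lambda>q t. wprod H d (w q t) - vd t)"
  define J where "J = (\<lambda>q. 1 / 2 * integral {0..T} (\<lambda>t. (\<rho> q t)\<^sup>2))"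
  define v where "v = (\<lambda>q t. vector_derivative (w q) (at t within {0..T}))"
  define kap where "kap = (\<lambda>t. vector_derivative lam (at t within {0..T}))"
  define \<mu> \<nu> where "\<mu> = (\<lambda>t. lam (T - t))" and "\<nu> = (\<lambda>t. - kap (T - t))"
  define l where "l = (\<lambda>X Y. integral {0..T} (\<lambda>t. wprod H (\<mu> t) (X *v w p t + Y *v v p t)))"
  interpret M: bounded_bilinear "(*v) :: ('n, 'n) rmat \<Rightarrow> _" by (rule bounded_bilinear_matrix_vector)
  interpret W: bounded_bilinear "wprod H" by (rule bounded_bilinear_wprod)
  have sol: "solution_pair T {0<..T} (A q) (B q) g (w q) (v q)"
    if "solves_ivp T {0<..T} (A q) (B q) g (w q)" for q
    unfolding v_def using that T by (intro solves_ivp_velocity) auto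
  have solp: "solution_pair T {0<..T} (A p) (B p) g (w p) (v p)"
    by (rule sol) (rule eventually_nhds_x_imp_x[OF forward])
  have adj: "solution_pair T {0..T} (A p) (B p) (\<lambda>\<tau>. - \<rho> p (T - \<tau>) *\<^sub>R d) lam kap"
    unfolding kap_def \<rho>_def using adjoint T by (intro solves_ivp_velocity) auto
  have rev: "(\<mu> has_vector_derivative \<nu> t) (at t within {0..T})" if "t \<in> {0..T}" for t
    unfolding \<mu>_def \<nu>_def using adj that by (rule adjoint_reversed(1))
  have \<nu>: "continuous_on {0..T} \<nu>"
    unfolding \<nu>_def
    by (intro continuous_on_minus
        continuous_on_compose2[OF solution_pair_continuous(2)[OF adj]] continuous_intros) auto
  have \<mu>': "vector_derivative (\<lambda>s. lam (T - s)) (at t within {0..T}) = \<nu> t" if "t \<in> {0..T}" for t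
    using rev[OF that] T that unfolding \<mu>_def by (intro vector_derivative_within_closed_interval)
  note contp = solution_pair_continuous[OF solp]
  have cont\<mu>: "continuous_on {0..T} \<mu>" "continuous_on {0..T} \<nu>"
    by (rule continuous_on_vector_derivative[OF rev], assumption) (rule \<nu>)
  have contM: "continuous_on {0..T} (\<lambda>t. X *v x t)" if "continuous_on {0..T} x"
      for X :: "('n, 'n) rmat" and x
    by (rule bounded_linear.continuous_on[OF matrix_vector_mul_bounded_linear that])
  note ints = integrable_continuous_real continuous_on_add continuous_on_diff continuous_on_minus
    continuous_on_mult continuous_on_power continuous_on_const W.continuous_on contM

  \<comment> \<open>The linear functional that is minus the derivative, before the integration by parts.\<close>
  have lint: "(\<lambda>t. wprod H (\<mu> t) (X *v w p t + Y *v v p t)) integrable_on {0..T}" for X Y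
    by (intro ints contp cont\<mu>)
  have "linear (\<lambda>(X, Y). l X Y)"
  proof (rule linearI; clarsimp)
    fix X Y X' Y' and c :: real
    show "l (X + X') (Y + Y') = l X Y + l X' Y'"
      unfolding l_def integral_add[OF lint lint, symmetric]
      by (simp add: M.add_left W.add_right algebra_simps)
    show "l (c *\<^sub>R X) (c *\<^sub>R Y) = c * l X Y"
      unfolding l_def integral_mult_right[symmetric]
      by (simp add: M.scaleR_left W.add_right W.scaleR_right algebra_simps)
  qed
  then have l: "bounded_linear (\<lambda>(X, Y). l X Y)"
    by (simp add: linear_conv_bounded_linear)
  have "((\<lambda>q. (A q - A p, B q - B p)) has_derivative (\<lambda>h. (A' h, B' h))) (at p)"
    by (auto intro!: derivative_eq_intros A B)
  from bounded_linear.has_derivative[OF l this]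
  have dl: "((\<lambda>q. l (A q - A p) (B q - B p)) has_derivative (\<lambda>h. l (A' h) (B' h))) (at p)"
    by simp

  \<comment> \<open>The boundary terms vanish because \<open>\<mu> T = 0\<close> and \<open>w p 0 = 0\<close>.\<close>
  have parts: "integral {0..T} (\<lambda>t. - wprod H (\<mu> t) (X *v w p t) + wprod H (\<nu> t) (Y *v w p t))
      = - l X Y"
    for X Y
  proof -
    have "((\<lambda>t. wprod H (\<mu> t) (Y *v v p t) + wprod H (\<nu> t) (Y *v w p t)) has_integral
        (wprod H (\<mu> T) (Y *v w p T) - wprod H (\<mu> 0) (Y *v w p 0))) {0..T}"
    proof (rule fundamental_theorem_of_calculus)
      fix t assume t: "t \<in> {0..T}"
      have "(w p has_vector_derivative v p t) (at t within {0..T})"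
        using solp t by (simp add: solution_pair_def)
      then show "((\<lambda>t. wprod H (\<mu> t) (Y *v w p t)) has_vector_derivative
          wprod H (\<mu> t) (Y *v v p t) + wprod H (\<nu> t) (Y *v w p t)) (at t within {0..T})"
        by (intro W.has_vector_derivative rev t
            bounded_linear.has_vector_derivative[OF matrix_vector_mul_bounded_linear])
    qed (use T in simp)
    moreover have "\<mu> T = 0" "w p 0 = 0"
      using solp adj by (simp_all add: \<mu>_def solution_pair_def)
    ultimately have "((\<lambda>t. wprod H (\<mu> t) (Y *v v p t) + wprod H (\<nu> t) (Y *v w p t))
        has_integral 0) {0..T}"
      by (simp add: W.zero_left W.zero_right M.zero_right)
    from has_integral_diff[OF this integrable_integral[OF lint[of X Y]]] show ?thesis
      unfolding l_def by (intro integral_unique) (simp add: W.add_right)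
  qed

  \<comment> \<open>The remainder is quadratic in \<open>q - p\<close>.\<close>
  define R where "R = (\<lambda>q. J q - J p + l (A q - A p) (B q - B p))"
  obtain CA where CA: "0 \<le> CA" "\<forall>\<^sub>F q in nhds p. norm (A q - A p) \<le> CA * norm (q - p)"
    by (rule has_derivative_lipschitz_at[OF A])
  obtain CB where CB: "0 \<le> CB" "\<forall>\<^sub>F q in nhds p. norm (B q - B p) \<le> CB * norm (q - p)"
    by (rule has_derivative_lipschitz_at[OF B])
  define C where "C = CA + CB"
  obtain K1 where K1: "0 < K1" "\<And>X x. norm (X *v x :: real^'n)
      \<le> norm (X :: ('n, 'n) rmat) * norm x * K1"
    using M.pos_bounded by blast
  obtain K2 where K2: "0 < K2" "\<And>x y. norm (wprod H x y) \<le> norm x * norm y * K2"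
    using W.pos_bounded by blast
  have bdd: "\<exists>b. 0 \<le> b \<and> (\<forall>t\<in>{0..T}. norm (x t) \<le> b)" if "continuous_on {0..T} x"
      for x :: "real \<Rightarrow> real^'n"
  proof -
    have "bounded (x ` {0..T})"
      by (intro compact_imp_bounded compact_continuous_image that compact_Icc)
    then obtain b where "0 < b" "\<forall>y\<in>x ` {0..T}. norm y \<le> b"
      unfolding bounded_pos by blast
    then show ?thesis by (intro exI[of _ b]) auto
  qed
  obtain bw where bw: "0 \<le> bw" "\<And>t. t \<in> {0..T} \<Longrightarrow> norm (w p t) \<le> bw"
    using bdd[OF contp(1)] by blast
  obtain bv where bv: "0 \<le> bv" "\<And>t. t \<in> {0..T} \<Longrightarrow> norm (v p t) \<le> bv"
    using bdd[OF contp(2)] by blast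
  obtain bm where bm: "0 \<le> bm" "\<And>t. t \<in> {0..T} \<Longrightarrow> norm (\<mu> t) \<le> bm"
    using bdd[OF cont\<mu>(1)] by blast
  define K where "K = (norm (A p) + norm (B p) + C) * K1"
  define E where "E = C * bw * K1 + C * bv * K1"
  define D where "D = E * sqrt (T * exp ((2 + 3 * K) * T))"
  define Q where "Q = 1 / 2 * (norm d * D * K2)\<^sup>2 + bm * (C * D * K1 + C * D * K1) * K2"
  have C: "0 \<le> C" "CA \<le> C" "CB \<le> C" using CA CB by (simp_all add: C_def)
  have K: "0 \<le> K" and E: "0 \<le> E" and D: "0 \<le> D"
    using C(1) K1(1) bw(1) bv(1) T by (simp_all add: K_def E_def D_def)
  have Q: "0 \<le> Q"
    using C(1) K1(1) K2(1) D bm(1) by (simp add: Q_def)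
  have "\<forall>\<^sub>F q in nhds p. norm (q - p) < 1"
    unfolding eventually_nhds_metric dist_norm by (intro exI[of _ 1]) simp
  with forward CA(2) CB(2)
  have "\<forall>\<^sub>F q in nhds p. norm (R q) \<le> (Q * T) * (norm (q - p))\<^sup>2"
  proof eventually_elim
    case (elim q)
    define N where "N = norm (q - p)"
    define u z where "u = (\<lambda>t. w q t - w p t)" and "z = (\<lambda>t. v q t - v p t)"
    define X Y where "X = A q - A p" and "Y = B q - B p"
    have N: "0 \<le> N" "N \<le> 1" using elim(4) by (simp_all add: N_def)
    have XY: "norm X \<le> C * N" "norm Y \<le> C * N"
      using elim(2,3) mult_right_mono[OF C(2) N(1)] mult_right_mono[OF C(3) N(1)]
      by (simp_all add: X_def Y_def N_def)
    have "C * N \<le> C" using mult_left_mono[OF N(2) C(1)] by simp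
    then have AB: "norm (A q) \<le> norm (A p) + norm (B p) + C" "norm (B q) \<le> norm (A p)
        + norm (B p) + C"
      using XY norm_triangle_sub[of "A q" "A p"] norm_triangle_sub[of "B q" "B p"]
      by (simp_all add: X_def Y_def add_increasing add_increasing2) (use norm_ge_zero in \<open>smt
          (verit)\<close>)+
    have Mb: "norm (Z *v x) \<le> a * b * K1" if "norm Z \<le> a" "norm x \<le> b"
        for Z :: "('n, 'n) rmat" and x a b
    proof -
      have "norm Z * norm x * K1 \<le> a * b * K1"
        using that K1(1) order_trans[OF norm_ge_zero that(1)]
            by (intro mult_right_mono mult_mono) auto
      then show ?thesis using K1(2)[of Z x] by simp
    qed
    have Wb: "norm (wprod H x y) \<le> a * b * K2" if "norm x \<le> a" "norm y \<le> b" for x y a b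
    proof -
      have "norm x * norm y * K2 \<le> a * b * K2"
        using that K2(1) order_trans[OF norm_ge_zero that(1)]
            by (intro mult_right_mono mult_mono) auto
      then show ?thesis using K2(2)[of x y] by simp
    qed
    have KAB: "norm (A q *v x) \<le> K * norm x" "norm (B q *v x) \<le> K * norm x" for x
      using Mb[OF AB(1) order_refl, of x] Mb[OF AB(2) order_refl, of x]
          by (simp_all add: K_def ac_simps)
    note solq = sol[OF elim(1)]

    \<comment> \<open>With the coefficients at \<open>q\<close>, the perturbation is driven by the solution at \<open>p\<close> alone.\<close>
    have "solution_pair T {0<..T} (A q) (B q) (\<lambda>t. X *v w p t + Y *v v p t) u z"
      unfolding X_def Y_def u_def z_def by (rule solution_pair_diff[OF solq solp])
    moreover have "norm (X *v w p t + Y *v v p t) \<le> N * E" if "t \<in> {0..T}" for t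
    proof -
      have "norm (X *v w p t) \<le> C * N * bw * K1" "norm (Y *v v p t) \<le> C * N * bv * K1"
        by (intro Mb XY bw bv that)+
      then show ?thesis
        using norm_triangle_ineq[of "X *v w p t" "Y *v v p t"] by (simp add: E_def algebra_simps)
    qed
    ultimately have uz: "norm (u t) \<le> N * D" "norm (z t) \<le> N * D" if "t \<in> {0..T}" for t
      using solution_pair_bound[of T "A q" "B q" "\<lambda>t. X *v w p t + Y *v v p t" u z K "N * E" t]
        KAB K N E that
      by (simp_all add: D_def mult.assoc)

    \<comment> \<open>With the coefficients at \<open>p\<close>, duality removes the first-order residual term.\<close>
    have "solution_pair T {0<..T} (A p) (B p) (\<lambda>t. (A p - A q) *v w q t + (B p - B q) *v v q t)
        (\<lambda>t. w p t - w q t) (\<lambda>t. v p t - v q t)"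
      by (rule solution_pair_diff[OF solp solq])
    from duality[OF less_imp_le[OF T] H this adj]
    have dual: "((\<lambda>t. \<rho> p t * wprod H d (w p t - w q t)
        + wprod H (\<mu> t) ((A p - A q) *v w q t + (B p - B q) *v v q t)) has_integral 0) {0..T}"
      unfolding \<mu>_def .
    note contq = solution_pair_continuous[OF solq]
    have int\<rho>: "(\<lambda>t. (\<rho> q t)\<^sup>2) integrable_on {0..T}" "(\<lambda>t. (\<rho> p t)\<^sup>2) integrable_on {0..T}"
      unfolding \<rho>_def by (intro ints contp contq vd)+
    have "((\<lambda>t. 1 / 2 * (\<rho> q t)\<^sup>2 - 1 / 2 * (\<rho> p t)\<^sup>2 + wprod H (\<mu> t) (X *v w p t + Y *v v p t)
        + (\<rho> p t * wprod H d (w p t - w q t)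
        + wprod H (\<mu> t) ((A p - A q) *v w q t + (B p - B q) *v v q t)))
        has_integral (R q + 0)) {0..T}"
      unfolding R_def J_def l_def X_def[symmetric] Y_def[symmetric]
      by (intro has_integral_add has_integral_diff has_integral_mult_right integrable_integral
          int\<rho> lint dual)
    moreover have "1 / 2 * (\<rho> q t)\<^sup>2 - 1 / 2 * (\<rho> p t)\<^sup>2 + wprod H (\<mu> t) (X *v w p t + Y *v v p t)
        + (\<rho> p t * wprod H d (w p t - w q t)
        + wprod H (\<mu> t) ((A p - A q) *v w q t + (B p - B q) *v v q t))
      = 1 / 2 * (wprod H d (u t))\<^sup>2 - wprod H (\<mu> t) (X *v u t + Y *v z t)" for t
    proof -
      have "\<rho> q t = \<rho> p t + wprod H d (u t)"
        by (simp add: \<rho>_def u_def W.diff_right)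
      then have "1 / 2 * (\<rho> q t)\<^sup>2 - 1 / 2 * (\<rho> p t)\<^sup>2 = \<rho> p t * wprod H d (u t)
          + 1 / 2 * (wprod H d (u t))\<^sup>2"
        by (simp add: power2_eq_square algebra_simps)
      moreover have "wprod H d (w p t - w q t) = - wprod H d (u t)"
        by (simp add: u_def W.diff_right)
      moreover have "(A p - A q) *v w q t + (B p - B q) *v v q t
          = - (X *v w p t + Y *v v p t) - (X *v u t + Y *v z t)"
        by (simp add: X_def Y_def u_def z_def M.diff_left M.diff_right)
      ultimately show ?thesis
        by (simp add: W.add_right W.diff_right W.minus_right)
    qed
    ultimately have rem: "((\<lambda>t. 1 / 2 * (wprod H d (u t))\<^sup>2 - wprod H (\<mu> t) (X *v u t
        + Y *v z t)) has_integral R q) {0..T}"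
      by simp
    have "norm (R q) \<le> (N\<^sup>2 * Q) * measure lborel {0..T}"
    proof (rule has_integral_bound_real[OF _ finite.emptyI rem])
      show "0 \<le> N\<^sup>2 * Q" using Q by simp
      show "norm (1 / 2 * (wprod H d (u t))\<^sup>2 - wprod H (\<mu> t) (X *v u t + Y *v z t)) \<le> N\<^sup>2 * Q"
        if "t \<in> {0..T} - {}" for t
      proof -
        have t: "t \<in> {0..T}" using that by simp
        have "norm (wprod H d (u t)) \<le> norm d * (N * D) * K2"
          by (intro Wb uz t order_refl)
        then have "(norm (wprod H d (u t)))\<^sup>2 \<le> (norm d * (N * D) * K2)\<^sup>2"
          by (intro power_mono) auto
        then have 1: "norm (1 / 2 * (wprod H d (u t))\<^sup>2) \<le> N\<^sup>2 * (1 / 2 * (norm d * D * K2)\<^sup>2)"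
          by (simp add: power_mult_distrib ac_simps)
        have "norm (X *v u t) \<le> C * N * (N * D) * K1" "norm (Y *v z t) \<le> C * N * (N * D) * K1"
          by (intro Mb XY uz t)+
        then have "norm (X *v u t + Y *v z t) \<le> C * N * (N * D) * K1 + C * N * (N * D) * K1"
          by (rule norm_triangle_mono)
        then have "norm (wprod H (\<mu> t) (X *v u t + Y *v z t)) \<le> bm * (C * N * (N * D) * K1
            + C * N * (N * D) * K1) * K2"
          by (intro Wb bm t)
        also have "\<dots> = N\<^sup>2 * (bm * (C * D * K1 + C * D * K1) * K2)"
          by (simp add: power2_eq_square algebra_simps)
        finally show "norm (1 / 2 * (wprod H d (u t))\<^sup>2 - wprod H (\<mu> t) (X *v u t + Y *v z t))
            \<le> N\<^sup>2 * Q"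
          using 1 norm_triangle_ineq4[of "1 / 2 * (wprod H d (u t))\<^sup>2" "wprod H (\<mu> t) (X *v u t
              + Y *v z t)"]
          unfolding Q_def distrib_left by linarith
      qed
    qed
    then show ?case using T by (simp add: N_def ac_simps)
  qed
  then have "(R has_derivative (\<lambda>h. 0)) (at p)"
    by (rule has_derivative_zero_of_quadratic_bound)
  from has_derivative_diff[OF has_derivative_add[OF this has_derivative_const[of "J p"]] dl]
  have "(J has_derivative (\<lambda>h. - l (A' h) (B' h))) (at p)"
    by (simp add: R_def)
  moreover have "- l (A' h) (B' h) = integral {0..T} (\<lambda>t. - wprod H (lam (T - t)) (A' h *v w p t)
        + wprod H (vector_derivative (\<lambda>s. lam (T - s)) (at t within {0..T})) (B' h *v w p t))" for h
    unfolding parts[symmetric] by (intro integral_cong) (simp add: \<mu>' , simp add: \<mu>_def)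
  ultimately show ?thesis
    by (simp add: J_def \<rho>_def)
qed

section \<open>The gradient of the loss\<close>

lemma partial_has_derivative:
  assumes F: "(F has_derivative F') (at p)"
  shows "partial i F p = F' (axis i 1)"
proof -
  have "((\<lambda>s. p + s *\<^sub>R axis i 1) has_derivative (\<lambda>s. s *\<^sub>R axis i 1)) (at 0)"
    by (auto intro!: derivative_eq_intros)
  moreover have "(F has_derivative F') (at (p + 0 *\<^sub>R axis i 1))"
    using F by simp
  ultimately have "((\<lambda>s. F (p + s *\<^sub>R axis i 1)) has_derivative (\<lambda>s. F' (s *\<^sub>R axis i 1))) (at 0)"
    by (rule has_derivative_compose)
  then have "((\<lambda>s. F (p + s *\<^sub>R axis i 1)) has_vector_derivative F' (axis i 1)) (at 0)"
    using linear_simps(5)[OF has_derivative_bounded_linear[OF F]]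
        by (simp add: has_vector_derivative_def)
  then show ?thesis
    unfolding partial_def by (rule vector_derivative_at)
qed

text \<open>
  Source and receiver lie in the upper block, where the norm matrix does not depend on the shape.
  Hence the misfit for a nearby shape can be written with the inner product at the base shape.
\<close>

lemma wprod_Hbar_point_vec:
  "wprod (Hbar S q) (point_vec S dx dy) u = wprod (Hbar S p) (point_vec S dx dy) u"
proof -
  obtain a b where "u = block_vec a b"
    by (rule block_vec_cases)
  then show ?thesis
    by (simp add: wprod_def Hbar_def point_vec_def block_mult_vec inner_block_vec)
qed

lemma has_derivative_regularization:
  assumes S: "valid_disc S"
  shows "((\<lambda>q. 1 / 2 * \<gamma> * wprod (Hn (opx S)) (D2 (opx S) *v q) (D2 (opx S) *v q)) has_derivative
    (\<lambda>h. \<gamma> * wprod (Hn (opx S)) (D2 (opx S) *v h) (D2 (opx S) *v p))) (at p)"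
proof -
  let ?H = "Hn (opx S)" and ?D = "D2 (opx S)"
  have "is_sbp (opx S)"
    using S by (simp add: valid_disc_def)
  then have "transpose ?H = ?H"
    by (intro is_diag_transpose sbp_Hn)
  then have sym: "wprod ?H x y = wprod ?H y x" for x y
    using wprod_self_adjoint[of ?H "mat 1" x y] unfolding wprod_def
        by (metis dot_lmul_matrix inner_commute transpose_matrix_vector)
  have D: "((*v) ?D has_derivative (*v) ?D) (at p)"
    by (rule bounded_linear_imp_has_derivative[OF matrix_vector_mul_bounded_linear])
  show ?thesis
    by (rule has_derivative_eq_rhs[OF has_derivative_mult_right[OF
            bounded_bilinear.FDERIV[OF bounded_bilinear_wprod D D]]])
      (simp add: sym[of "?D *v p"])
qed

theorem lemma4:
  fixes S :: "('m::{finite, linorder}, 'n::{finite, linorder}, 'k::{finite, linorder}) disc"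
    and p :: "'m rvec"
    and T \<gamma> :: real
    and f vd :: "real \<Rightarrow> real"
    and dxs dxr :: "'m rvec" and dys dyr :: "'n rvec"
    and ds dr :: "('m, 'n, 'k) state"
    and w :: "'m rvec \<Rightarrow> real \<Rightarrow> ('m, 'n, 'k) state"
    and lam :: "real \<Rightarrow> ('m, 'n, 'k) state"
  assumes disc: "valid_disc S"
    and conforming: "Hsp S = Hnm S p"
    and p: "admissible S p"
    and T: "0 < T"
    and f: "continuous_on {0..T} f"
    and vd: "continuous_on {0..T} vd"
    and ds: "ds = point_vec S dxs dys"
    and dr: "dr = point_vec S dxr dyr"
    and forward: "\<And>q. admissible S q \<Longrightarrow>
      solves_ivp T {0<..T} (Dop S q) (Eop S q) (\<lambda>t. f t *\<^sub>R ds) (w q)"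
    and adjoint: "solves_ivp T {0..T} (Dop S p) (Eop S p)
      (\<lambda>\<tau>. - residual S dr vd p (w p) (T - \<tau>) *\<^sub>R dr) lam"
  shows "(\<lambda>q. loss S dr vd T \<gamma> (w q) q) differentiable (at p) \<and>
    (\<forall>i. partial i (\<lambda>q. loss S dr vd T \<gamma> (w q) q) p =
      integral {0..T} (\<lambda>t.
        - wprod (Hbar S p) (lam (T - t)) (partial i (Dop S) p *v w p t)
        + wprod (Hbar S p) (vector_derivative (\<lambda>s. lam (T - s)) (at t within {0..T}))
            (partial i (Eop S) p *v w p t))
      + \<gamma> * wprod (Hn (opx S)) (D2 (opx S) *v axis i 1) (D2 (opx S) *v p))"
proof -
  let ?F = "\<lambda>q. loss S dr vd T \<gamma> (w q) q"
  have sym: "transpose (Hbar S p) = Hbar S p"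
    by (intro is_diag_transpose Hbar_diag disc p)
  have res: "residual S dr vd q (w q) t = wprod (Hbar S p) dr (w q t) - vd t" for q t
    unfolding residual_def dr wprod_Hbar_point_vec[of S q _ _ _ p] ..
  obtain D' where D': "(Dop S has_derivative D') (at p)"
    using differentiable_Dop_Eop(1)[OF disc p] by (auto simp: differentiable_def)
  obtain E' where E': "(Eop S has_derivative E') (at p)"
    using differentiable_Dop_Eop(2)[OF disc p] by (auto simp: differentiable_def)
  have "((\<lambda>q. 1 / 2 * integral {0..T} (\<lambda>t. (wprod (Hbar S p) dr (w q t) - vd t)\<^sup>2)) has_derivative
    (\<lambda>h. integral {0..T} (\<lambda>t. - wprod (Hbar S p) (lam (T - t)) (D' h *v w p t)
        + wprod (Hbar S p) (vector_derivative (\<lambda>s. lam (T - s)) (at t within {0..T})) (E' h *v w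
            p t)))) (at p)"
  proof (rule reduced_gradient[OF T D' E' sym symmetric_Dop[OF disc p conforming]
      symmetric_Eop[OF disc p] vd])
    show "\<forall>\<^sub>F q in nhds p. solves_ivp T {0<..T} (Dop S q) (Eop S q) (\<lambda>t. f t *\<^sub>R ds) (w q)"
      using eventually_admissible[OF p] by (rule eventually_mono) (rule forward)
    show "solves_ivp T {0..T} (Dop S p) (Eop S p)
      (\<lambda>\<tau>. - (wprod (Hbar S p) dr (w p (T - \<tau>)) - vd (T - \<tau>)) *\<^sub>R dr) lam"
      using adjoint unfolding residual_def .
  qed
  from has_derivative_add[OF this has_derivative_regularization[OF disc, of \<gamma> p]]
  have F: "(?F has_derivative (\<lambda>h. integral {0..T} (\<lambda>t. - wprod (Hbar S p) (lam (T - t)) (D' h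
      *v w p t)
        + wprod (Hbar S p) (vector_derivative (\<lambda>s. lam (T - s)) (at t within {0..T})) (E' h *v w
            p t))
      + \<gamma> * wprod (Hn (opx S)) (D2 (opx S) *v h) (D2 (opx S) *v p))) (at p)"
    unfolding loss_def res .
  then show ?thesis
    unfolding partial_has_derivative[OF F] partial_has_derivative[OF D']
        partial_has_derivative[OF E']
    by (auto simp: differentiable_def)
qed

end
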